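(* Let $S$ be the operator on $L^2_p(0,l)$ with $D$-difference kernel $$(Sf)(x)=f(x)+\int_0^l k(x,t)f(t)\,dt,\qquad k(x,t)=\{k_{ij}(d_ix-d_jt)\}_{i,j=1}^p,$$ where $k_{ij}(\cdot)$ are the entries of the $p\times p$ matrix function $$k(x)=\Theta_2^*e^{ix\beta^*}\Theta_1\quad(0<x<d_1l),\qquad k(-x)=k(x)^*,$$ $\Theta_1,\Theta_2$ are $n\times p$ matrices and $\beta$ is an $n\times n$ matrix, and where $D=\mathrm{diag}\{d_1,\dots,d_p\}=\mathrm{diag}\{\widetilde d_1I_{p_1},\dots,\widetilde d_kI_{p_k}\}$ with $p_1+\dots+p_k=p$ and $\widetilde d_1>\widetilde d_2>\dots>\widetilde d_k>0$. Let $a=d_1l$, and let $U$, $B$, $C$, $P^\times$, $E$, $\widetilde J$ be as defined in the context. Assume that $\det U_{22}(a)\neq 0$, where $U_{22}(a)$ is the lower right $n\times n$ block of $U(a)$. Then $S$ is invertible and $$S^{-1}=E^{-1}\widetilde T E,\qquad \widetilde T=I+\int_0^a\widetilde T(y,z)\,\cdot\,dz,$$ $$\widetilde T(y,z)=\begin{cases} C(y)U(y)\big(I_{2n}-P^{\times}\big)U(z)^{-1}B(z), & y>z,\\ -C(y)U(y)P^{\times}U(z)^{-1}B(z), & y<z.\end{cases}$$ Moreover, the matrix function $U$ is $\widetilde J$-unitary, i.e. $U(y)^*\widetilde JU(y)=\widetilde J$ for $0\le y\le a$.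
   Context: Fix $0<l<\infty$, positive integers $p,n$, and $D$, $\Theta_1,\Theta_2,\beta$ as in the claim (all matrices complex). $L^2_p(0,l)$ is the space of $\mathbb C^p$-valued square integrable functions on $(0,l)$; $I$ is the identity operator; $I_m$ is the $m\times m$ identity matrix. Put $a=d_1l=\widetilde d_1l$. Operator $E$: $E:L^2_p(0,l)\to L^2_p(0,a)$ is given by $(Ef)_j(z)=f_j(z/d_j)$ for $0<z<d_jl$ and $(Ef)_j(z)=0$ for $d_jl<z<a$. Its image is naturally identified with $L^2(0,d_1l)\oplus\dots\oplus L^2(0,d_pl)$, and $E^{-1}$ is the inverse of $E$ on its image. Put $\widetilde d_{k+1}=0$, $P_{k+1}=I_p$, and for $2\le j\le k$ let $P_j=\mathrm{diag}\{I_{p_1},\dots,I_{p_{j-1}},0,\dots,0\}$ ($p\times p$). Let $$\mathcal A=i\begin{bmatrix}\beta^*&0\\0&\beta\end{bmatrix},\quad Y_j=\begin{bmatrix}-\Theta_1\\ \Theta_2\end{bmatrix}D^{-1}P_j\begin{bmatrix}\Theta_2^*&\Theta_1^*\end{bmatrix},\quad \mathcal A_j^\times=\mathcal A+Y_j,\quad \widetilde J=\begin{bmatrix}0&-I_n\\ I_n&0\end{bmatrix}.$$ For $\widetilde d_jl<y<\widetilde d_{j-1}l$ ($2\le j\le k+1$) put $$B(y)=e^{-y\mathcal A}\begin{bmatrix}-\Theta_1\\ \Theta_2\end{bmatrix}D^{-1}P_j,\qquad C(y)=P_j\begin{bmatrix}\Theta_2^*&\Theta_1^*\end{bmatrix}e^{y\mathcal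 A}.$$ The $2n\times2n$ matrix function $U$ on $[0,a]$ is defined recursively (starting from $j=k+1$ and going down to $j=2$) by $U(0)=I_{2n}$ and $$U(y)=e^{-y\mathcal A}e^{(y-\widetilde d_jl)\mathcal A_j^\times}e^{\widetilde d_jl\mathcal A}U(\widetilde d_jl),\qquad \widetilde d_jl\le y\le\widetilde d_{j-1}l,\quad 2\le j\le k+1.$$ Writing $U(a)=\begin{bmatrix}U_{11}(a)&U_{12}(a)\\ U_{21}(a)&U_{22}(a)\end{bmatrix}$ with $n\times n$ blocks, put $$P^\times=\begin{bmatrix}0&0\\ U_{22}(a)^{-1}U_{21}(a)&I_n\end{bmatrix}.$$ *)

theory Defs
  imports "HOL-Analysis.Analysis"
begin

text \<open>An $r \times c$ matrix has type \<open>complex^'c^'r\<close>; a $2n$-dimensional index set is the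
  sum type \<open>'n + 'n\<close>. On \<open>^\<close>, the type class multiplication is componentwise, so the
  library function \<open>exp\<close> is not the matrix exponential.\<close>

definition cadj :: "complex^'c^'r \<Rightarrow> complex^'r^'c" where
  "cadj A = (\<chi> i j. cnj (A $ j $ i))"

definition cscale :: "complex \<Rightarrow> complex^'c^'r \<Rightarrow> complex^'c^'r" where
  "cscale c A = (\<chi> i j. c * A $ i $ j)"

definition diagm :: "('p \<Rightarrow> complex) \<Rightarrow> complex^'p^'p" where
  "diagm v = (\<chi> i j. if i = j then v i else 0)"

definition mexp :: "complex^'m^'m \<Rightarrow> complex^'m^'m" where
  "mexp A = (\<Sum>m. inverse (fact m) *\<^sub>R (((**) A ^^ m) (mat 1)))"

definition vstack :: "complex^'c^'r \<Rightarrow> complex^'c^'s \<Rightarrow> complex^'c^('r + 's)" where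
  "vstack X Y = (\<chi> i. case i of Inl a \<Rightarrow> X $ a | Inr b \<Rightarrow> Y $ b)"

definition hstack :: "complex^'c^'r \<Rightarrow> complex^'e^'r \<Rightarrow> complex^('c + 'e)^'r" where
  "hstack X Y = (\<chi> i j. case j of Inl a \<Rightarrow> X $ i $ a | Inr b \<Rightarrow> Y $ i $ b)"

definition block :: "complex^'c^'r \<Rightarrow> complex^'e^'r \<Rightarrow> complex^'c^'s \<Rightarrow> complex^'e^'s
    \<Rightarrow> complex^('c + 'e)^('r + 's)" where
  "block X11 X12 X21 X22 = vstack (hstack X11 X12) (hstack X21 X22)"

definition block21 :: "complex^('c + 'e::finite)^('r::finite + 's) \<Rightarrow> complex^'c^'s" where
  "block21 M = (\<chi> i j. M $ Inr i $ Inl j)"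

definition block22 :: "complex^('c::finite + 'e)^('r::finite + 's) \<Rightarrow> complex^'e^'s" where
  "block22 M = (\<chi> i j. M $ Inr i $ Inr j)"

text \<open>Elements of $L^2_p(0,l)$ are represented by functions on the whole line, whose values
  off \<open>(0,l)\<close> are irrelevant, and equality is equality a.e. on \<open>(0,l)\<close>. Accordingly, all
  operator identities below are understood modulo \<open>ae_eq\<close>.\<close>

definition L2 :: "real \<Rightarrow> (real \<Rightarrow> complex^'p) set" where
  "L2 l = {f. f \<in> borel_measurable (lebesgue_on {0<..<l}) \<and>
              integrable (lebesgue_on {0<..<l}) (\<lambda>x. (norm (f x))\<^sup>2)}"

definition ae_eq :: "real \<Rightarrow> (real \<Rightarrow> complex^'p) \<Rightarrow> (real \<Rightarrow> complex^'p) \<Rightarrow> bool" where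
  "ae_eq l f g \<longleftrightarrow> (AE x in lebesgue_on {0<..<l}. f x = g x)"

definition L2norm :: "real \<Rightarrow> (real \<Rightarrow> complex^'p) \<Rightarrow> real" where
  "L2norm l f = sqrt (LINT x|lebesgue_on {0<..<l}. (norm (f x))\<^sup>2)"

text \<open>Boundedness together with additivity forces such a map to respect \<open>ae_eq\<close>.\<close>

definition L2_bounded_operator ::
    "real \<Rightarrow> ((real \<Rightarrow> complex^'p) \<Rightarrow> (real \<Rightarrow> complex^'p)) \<Rightarrow> bool" where
  "L2_bounded_operator l T \<longleftrightarrow>
     (\<forall>f \<in> L2 l. T f \<in> L2 l) \<and>
     (\<forall>f \<in> L2 l. \<forall>g \<in> L2 l. ae_eq l (T (\<lambda>x. f x + g x)) (\<lambda>x. T f x + T g x)) \<and>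
     (\<forall>c. \<forall>f \<in> L2 l. ae_eq l (T (\<lambda>x. c *s f x)) (\<lambda>x. c *s T f x)) \<and>
     (\<exists>K. \<forall>f \<in> L2 l. L2norm l (T f) \<le> K * L2norm l f)"

definition L2_inverse ::
    "real \<Rightarrow> ((real \<Rightarrow> complex^'p) \<Rightarrow> (real \<Rightarrow> complex^'p))
      \<Rightarrow> ((real \<Rightarrow> complex^'p) \<Rightarrow> (real \<Rightarrow> complex^'p)) \<Rightarrow> bool" where
  "L2_inverse l S R \<longleftrightarrow>
     L2_bounded_operator l S \<and> L2_bounded_operator l R \<and>
     (\<forall>f \<in> L2 l. ae_eq l (S (R f)) f) \<and>
     (\<forall>f \<in> L2 l. ae_eq l (R (S f)) f)"

definition L2_invertible ::
    "real \<Rightarrow> ((real \<Rightarrow> complex^'p) \<Rightarrow> (real \<Rightarrow> complex^'p)) \<Rightarrow> bool" where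
  "L2_invertible l S \<longleftrightarrow> (\<exists>R. L2_inverse l S R)"

text \<open>The index type \<open>'p\<close> is linearly ordered, so that \<open>pos i\<close> is the usual index
  $1, \dots, p$ of \<open>i\<close>. The data are the block sizes $p_1, \dots, p_k$ and the distinct values
  $\widetilde d_1, \dots, \widetilde d_k$, given as \<open>ps j\<close> and \<open>dt j\<close> for \<open>1 \<le> j \<le> k\<close>.\<close>

definition pos :: "'p::{finite,linorder} \<Rightarrow> nat" where
  "pos i = card {i'. i' \<le> i}"

definition blk :: "(nat \<Rightarrow> nat) \<Rightarrow> 'p::{finite,linorder} \<Rightarrow> nat" where
  "blk ps i = (LEAST j. pos i \<le> (\<Sum>m=1..j. ps m))"

definition dd :: "(nat \<Rightarrow> nat) \<Rightarrow> (nat \<Rightarrow> real) \<Rightarrow> 'p::{finite,linorder} \<Rightarrow> real" where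
  "dd ps dt i = dt (blk ps i)"

definition DD :: "(nat \<Rightarrow> nat) \<Rightarrow> (nat \<Rightarrow> real)
    \<Rightarrow> complex^'p::{finite,linorder}^'p::{finite,linorder}" where
  "DD ps dt = diagm (\<lambda>i. complex_of_real (dd ps dt i))"

text \<open>For \<open>j = k + 1\<close> this is the identity matrix, since $p_1 + \dots + p_k = p$.\<close>

definition PP :: "(nat \<Rightarrow> nat) \<Rightarrow> nat \<Rightarrow> complex^'p::{finite,linorder}^'p::{finite,linorder}" where
  "PP ps j = diagm (\<lambda>i. if pos i \<le> (\<Sum>m=1..j-1. ps m) then 1 else 0)"

definition kfun :: "complex^'p^'n \<Rightarrow> complex^'p^'n \<Rightarrow> complex^'n^'n \<Rightarrow> real \<Rightarrow> complex^'p^'p" where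
  "kfun \<Theta>1 \<Theta>2 \<beta> x =
     (if x > 0 then cadj \<Theta>2 ** mexp (cscale (\<i> * complex_of_real x) (cadj \<beta>)) ** \<Theta>1
      else cadj (cadj \<Theta>2 ** mexp (cscale (\<i> * complex_of_real (- x)) (cadj \<beta>)) ** \<Theta>1))"

definition S_op :: "real \<Rightarrow> ('p \<Rightarrow> real) \<Rightarrow> complex^'p^'n \<Rightarrow> complex^'p^'n \<Rightarrow> complex^'n^'n
    \<Rightarrow> (real \<Rightarrow> complex^'p) \<Rightarrow> (real \<Rightarrow> complex^'p)" where
  "S_op l d \<Theta>1 \<Theta>2 \<beta> f x =
     f x + (LINT t|lebesgue_on {0<..<l}.
              (\<chi> i j. kfun \<Theta>1 \<Theta>2 \<beta> (d i * x - d j * t) $ i $ j) *v f t)"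

definition E_op :: "real \<Rightarrow> ('p \<Rightarrow> real) \<Rightarrow> (real \<Rightarrow> complex^'p) \<Rightarrow> (real \<Rightarrow> complex^'p)" where
  "E_op l d f z = (\<chi> j. if 0 < z \<and> z < d j * l then f (z / d j) $ j else 0)"

text \<open>$E^{-1}$ is the inverse of $E : L^2_p(0,l) \to L^2_p(0,a)$ on its image; the choice is unique up
  to \<open>ae_eq l\<close> for arguments satisfying \<open>in_range_E\<close>, and arbitrary for others.\<close>

definition in_range_E :: "real \<Rightarrow> real \<Rightarrow> ('p \<Rightarrow> real) \<Rightarrow> (real \<Rightarrow> complex^'p) \<Rightarrow> bool" where
  "in_range_E l a d g \<longleftrightarrow> (\<exists>f \<in> L2 l. ae_eq a (E_op l d f) g)"

definition E_inv :: "real \<Rightarrow> real \<Rightarrow> ('p \<Rightarrow> real) \<Rightarrow> (real \<Rightarrow> complex^'p) \<Rightarrow> (real \<Rightarrow> complex^'p)" where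
  "E_inv l a d g = (SOME f. f \<in> L2 l \<and> ae_eq a (E_op l d f) g)"

definition AA :: "complex^'n^'n \<Rightarrow> complex^('n + 'n)^('n + 'n)" where
  "AA \<beta> = cscale \<i> (block (cadj \<beta>) 0 0 \<beta>)"

definition YY :: "(nat \<Rightarrow> nat) \<Rightarrow> (nat \<Rightarrow> real) \<Rightarrow> complex^'p::{finite,linorder}^'n
    \<Rightarrow> complex^'p::{finite,linorder}^'n
    \<Rightarrow> nat \<Rightarrow> complex^('n + 'n)^('n + 'n)" where
  "YY ps dt \<Theta>1 \<Theta>2 j =
     vstack (- \<Theta>1) \<Theta>2 ** matrix_inv (DD ps dt) ** PP ps j ** hstack (cadj \<Theta>2) (cadj \<Theta>1)"

definition AAx :: "(nat \<Rightarrow> nat) \<Rightarrow> (nat \<Rightarrow> real) \<Rightarrow> complex^'p::{finite,linorder}^'n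
    \<Rightarrow> complex^'p::{finite,linorder}^'n
    \<Rightarrow> complex^'n^'n \<Rightarrow> nat \<Rightarrow> complex^('n + 'n)^('n + 'n)" where
  "AAx ps dt \<Theta>1 \<Theta>2 \<beta> j = AA \<beta> + YY ps dt \<Theta>1 \<Theta>2 j"

definition JJ :: "complex^('n::finite + 'n)^('n + 'n)" where
  "JJ = block 0 (- mat 1) (mat 1) 0"

text \<open>The index of the open interval containing \<open>y\<close>; unspecified at the finitely many points
  $\widetilde d_j l$. Here \<open>dt (k + 1)\<close> is
  meant to be $\widetilde d_{k+1} = 0$.\<close>

definition piece :: "real \<Rightarrow> nat \<Rightarrow> (nat \<Rightarrow> real) \<Rightarrow> real \<Rightarrow> nat" where
  "piece l k dt y = (THE j. 2 \<le> j \<and> j \<le> k + 1 \<and> dt j * l < y \<and> y < dt (j - 1) * l)"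

definition BB :: "real \<Rightarrow> nat \<Rightarrow> (nat \<Rightarrow> nat) \<Rightarrow> (nat \<Rightarrow> real) \<Rightarrow> complex^'p::{finite,linorder}^'n
    \<Rightarrow> complex^'p::{finite,linorder}^'n \<Rightarrow> complex^'n^'n \<Rightarrow> real \<Rightarrow> complex^'p::{finite,linorder}^('n + 'n)" where
  "BB l k ps dt \<Theta>1 \<Theta>2 \<beta> y =
     mexp ((- y) *\<^sub>R AA \<beta>) ** vstack (- \<Theta>1) \<Theta>2 ** matrix_inv (DD ps dt) ** PP ps (piece l k dt y)"

definition CC :: "real \<Rightarrow> nat \<Rightarrow> (nat \<Rightarrow> nat) \<Rightarrow> (nat \<Rightarrow> real) \<Rightarrow> complex^'p::{finite,linorder}^'n
    \<Rightarrow> complex^'p::{finite,linorder}^'n \<Rightarrow> complex^'n^'n \<Rightarrow> real \<Rightarrow> complex^('n + 'n)^'p::{finite,linorder}" where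
  "CC l k ps dt \<Theta>1 \<Theta>2 \<beta> y =
     PP ps (piece l k dt y) ** hstack (cadj \<Theta>2) (cadj \<Theta>1) ** mexp (y *\<^sub>R AA \<beta>)"

text \<open>\<open>UU_upto l k ps dt \<Theta>1 \<Theta>2 \<beta> m\<close> is the function $U$ on $[0, \widetilde d_{k+1-m} l]$: the
  step from \<open>m\<close> to \<open>m + 1\<close> adds the interval with index \<open>j = k + 1 - m\<close>. Thus \<open>j\<close> runs from
  \<open>k + 1\<close> down to \<open>2\<close>, and after \<open>k\<close> steps $U$ is defined on $[0,a]$.\<close>

primrec UU_upto :: "real \<Rightarrow> nat \<Rightarrow> (nat \<Rightarrow> nat) \<Rightarrow> (nat \<Rightarrow> real) \<Rightarrow> complex^'p::{finite,linorder}^'n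
    \<Rightarrow> complex^'p::{finite,linorder}^'n \<Rightarrow> complex^'n^'n \<Rightarrow> nat \<Rightarrow> real
    \<Rightarrow> complex^('n + 'n)^('n + 'n)" where
  "UU_upto l k ps dt \<Theta>1 \<Theta>2 \<beta> 0 = (\<lambda>y. mat 1)"
| "UU_upto l k ps dt \<Theta>1 \<Theta>2 \<beta> (Suc m) =
     (\<lambda>y. let j = k + 1 - m in
        if y \<le> dt j * l then UU_upto l k ps dt \<Theta>1 \<Theta>2 \<beta> m y
        else mexp ((- y) *\<^sub>R AA \<beta>) ** mexp ((y - dt j * l) *\<^sub>R AAx ps dt \<Theta>1 \<Theta>2 \<beta> j)
               ** mexp ((dt j * l) *\<^sub>R AA \<beta>) ** UU_upto l k ps dt \<Theta>1 \<Theta>2 \<beta> m (dt j * l))"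

definition UU :: "real \<Rightarrow> nat \<Rightarrow> (nat \<Rightarrow> nat) \<Rightarrow> (nat \<Rightarrow> real) \<Rightarrow> complex^'p::{finite,linorder}^'n
    \<Rightarrow> complex^'p::{finite,linorder}^'n \<Rightarrow> complex^'n^'n \<Rightarrow> real
    \<Rightarrow> complex^('n + 'n)^('n + 'n)" where
  "UU l k ps dt \<Theta>1 \<Theta>2 \<beta> = UU_upto l k ps dt \<Theta>1 \<Theta>2 \<beta> k"

text \<open>At the left end point $y = \widetilde d_j l$ the formula is trivially true, as then the three
  exponentials multiply to the identity.\<close>

lemma UU_rec:
  assumes l: "0 < l" and dec: "\<And>j. j \<in> {1..<k} \<Longrightarrow> dt (j + 1) < dt j"
    and pos: "0 < dt k" and last: "dt (k + 1) = 0"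
  shows "UU l k ps dt \<Theta>1 \<Theta>2 \<beta> 0 = mat 1"
    and "\<And>j y. \<lbrakk>2 \<le> j; j \<le> k + 1; dt j * l < y; y \<le> dt (j - 1) * l\<rbrakk> \<Longrightarrow>
      UU l k ps dt \<Theta>1 \<Theta>2 \<beta> y =
        mexp ((- y) *\<^sub>R AA \<beta>) ** mexp ((y - dt j * l) *\<^sub>R AAx ps dt \<Theta>1 \<Theta>2 \<beta> j)
          ** mexp ((dt j * l) *\<^sub>R AA \<beta>) ** UU l k ps dt \<Theta>1 \<Theta>2 \<beta> (dt j * l)"
proof -
  have st: "dt (k + 1 - m) * l \<le> dt (k + 1 - Suc m) * l" if "Suc m \<le> k" for m
  proof (cases "m = 0")
    case True
    then show ?thesis using l pos last by simp
  next
    case False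
    then have "k - m \<in> {1..<k}" using that by auto
    from dec[OF this] have "dt (k + 1 - m) < dt (k - m)" using that by (simp add: Suc_diff_le)
    then show ?thesis using l by simp
  qed
  have mono: "dt (k + 1 - m) * l \<le> dt (k + 1 - m') * l" if "m \<le> m'" "m' \<le> k" for m m'
    using that
  proof (induction m' rule: dec_induct)
    case (step n)
    then show ?case using st[of n] by simp
  qed simp
  have ext: "UU_upto l k ps dt \<Theta>1 \<Theta>2 \<beta> m' y = UU_upto l k ps dt \<Theta>1 \<Theta>2 \<beta> m y"
    if "m \<le> m'" "m' \<le> k" "y \<le> dt (k + 1 - m) * l" for m m' y
    using that
  proof (induction m' rule: dec_induct)
    case (step n)
    then have "y \<le> dt (k + 1 - n) * l" using mono[of m n] by simp
    then show ?case using step by simp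
  qed simp
  show "UU l k ps dt \<Theta>1 \<Theta>2 \<beta> 0 = mat 1"
    using ext[of 0 k 0] last by (simp add: UU_def)
  fix j y assume j: "2 \<le> j" "j \<le> k + 1" and y: "dt j * l < y" "y \<le> dt (j - 1) * l"
  define m where "m = k + 1 - j"
  have m: "j = k + 1 - m" "j - 1 = k + 1 - Suc m" "Suc m \<le> k" using j by (auto simp: m_def)
  have kj: "Suc k - m = j" using m by simp
  have "UU l k ps dt \<Theta>1 \<Theta>2 \<beta> y = UU_upto l k ps dt \<Theta>1 \<Theta>2 \<beta> (Suc m) y"
    unfolding UU_def using ext[of "Suc m" k y] m y by simp
  moreover have "UU l k ps dt \<Theta>1 \<Theta>2 \<beta> (dt j * l) = UU_upto l k ps dt \<Theta>1 \<Theta>2 \<beta> m (dt j * l)"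
    unfolding UU_def using ext[of m k "dt j * l"] m by simp
  ultimately show "UU l k ps dt \<Theta>1 \<Theta>2 \<beta> y =
        mexp ((- y) *\<^sub>R AA \<beta>) ** mexp ((y - dt j * l) *\<^sub>R AAx ps dt \<Theta>1 \<Theta>2 \<beta> j)
          ** mexp ((dt j * l) *\<^sub>R AA \<beta>) ** UU l k ps dt \<Theta>1 \<Theta>2 \<beta> (dt j * l)"
    using y by (simp add: Let_def kj)
qed

definition Pcross :: "complex^('n::finite + 'n)^('n + 'n) \<Rightarrow> complex^('n + 'n)^('n + 'n)" where
  "Pcross Ua = block 0 0 (matrix_inv (block22 Ua) ** block21 Ua) (mat 1)"

text \<open>The kernel is irrelevant on the diagonal, where it is set to 0.\<close>

definition T_kernel :: "real \<Rightarrow> nat \<Rightarrow> (nat \<Rightarrow> nat) \<Rightarrow> (nat \<Rightarrow> real) \<Rightarrow> complex^'p::{finite,linorder}^'n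
    \<Rightarrow> complex^'p::{finite,linorder}^'n \<Rightarrow> complex^'n^'n \<Rightarrow> real \<Rightarrow> real
    \<Rightarrow> complex^'p::{finite,linorder}^'p::{finite,linorder}" where
  "T_kernel l k ps dt \<Theta>1 \<Theta>2 \<beta> y z =
     (let U = UU l k ps dt \<Theta>1 \<Theta>2 \<beta>; B = BB l k ps dt \<Theta>1 \<Theta>2 \<beta>; C = CC l k ps dt \<Theta>1 \<Theta>2 \<beta>;
          Px = Pcross (U (dt 1 * l)) in
      if y > z then C y ** U y ** (mat 1 - Px) ** matrix_inv (U z) ** B z
      else if y < z then - (C y ** U y ** Px ** matrix_inv (U z) ** B z)
      else 0)"

definition T_op :: "real \<Rightarrow> nat \<Rightarrow> (nat \<Rightarrow> nat) \<Rightarrow> (nat \<Rightarrow> real) \<Rightarrow> complex^'p::{finite,linorder}^'n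
    \<Rightarrow> complex^'p::{finite,linorder}^'n \<Rightarrow> complex^'n^'n
    \<Rightarrow> (real \<Rightarrow> complex^'p::{finite,linorder}) \<Rightarrow> (real \<Rightarrow> complex^'p::{finite,linorder})" where
  "T_op l k ps dt \<Theta>1 \<Theta>2 \<beta> g y =
     g y + (LINT z|lebesgue_on {0<..<dt 1 * l}. T_kernel l k ps dt \<Theta>1 \<Theta>2 \<beta> y z *v g z)"

end

theory Submission
  imports Defs
begin

text \<open>On the image of $E$, the operator $E S E^{-1}$ is the identity plus the integral operator on
$(0,a)$ with kernel $P(y)\,k(y-z)\,D^{-1}P(z)$, where $P(y)$ projects onto the components
\<open>i\<close> with $y < d_i l$. Since $k$ is built from matrix exponentials, and an exponential of
$y - z$ is a product of a function of $y$ and a function of $z$, this kernel is semi-separable: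
it is $-C(y)QB(z)$ for $z < y$ and $C(y)PB(z)$ for $z \ge y$, where \<open>Q\<close> (\<open>proj1\<close>)
and \<open>P\<close> (\<open>proj2\<close>) are the complementary coordinate projections of
$\mathbb C^{2n}$. The proposed inverse is of the same kind, with $C U$ and $U^{-1} B$ in place of
$C$ and $B$ and with the complementary projections $I - P^\times$ and $P^\times$.

\<^medskip>
Two semi-separable kernels can be composed in closed form as soon as the product of the inner
factors has a known primitive (\<open>semisep_comp\<close>). Here $U$ solves $U' = BCU$, so $U$ is a
primitive of $B \cdot CU$, and therefore $U^{-1}$ is a primitive of $U^{-1}B \cdot (-C)$: both
orders of composition are covered. The contributions of the end points $0$ and $a$ cancel because
of the four relations $QP^\times = 0$, $(I-P^\times)P = 0$, $PU(a)(I-P^\times) = 0$ and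
$P^\times U(a)^{-1}Q = 0$. They determine $P^\times$, and the last two are where
the invertibility of $U_{22}(a)$ enters. What remains says that for the two kernels $K$ and $T$
both compositions equal $-K-T$, which by Fubini's theorem means that $I + K$ and $I + T$ are
inverse to each other.

\<^medskip>
The computation lives on $(0,a)$, the operator $S$ on $(0,l)$. The substitution $z = d_j t$ in the
\<open>j\<close>-th component (\<open>dilate_kernel\<close>) carries kernels supported in the image of $E$
to bounded kernels on $(0,l)$ and respects composition (\<open>dilate_kernel_comp\<close>). The
kernel of $S$ is obtained in this way (\<open>dilate_Sker\<close>), and $E$ intertwines the operators on the two intervals
(\<open>E_kernel_op\<close>). Since $E$ is injective up to null sets, the choice made in
$E^{-1}$ is immaterial.

\<^medskip>
The matrices $\mathcal A$ and $\mathcal A_j^\times$ are skew for the form given by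
$\widetilde J$, so their exponentials preserve it, and $U$ is a product of such exponentials.
This yields the last claim, and also the formula $U^{-1} = -\widetilde J U^* \widetilde J$, from
which the invertibility, continuity and differentiability of $U^{-1}$ are read off.\<close>

section \<open>Matrix algebra and the matrix exponential\<close>

lemma bounded_bilinear_matrix_matrix_mult:
  "bounded_bilinear ((**) :: complex^'b^'a \<Rightarrow> complex^'c^'b \<Rightarrow> complex^'c^'a)"
  unfolding bilinear_conv_bounded_bilinear[symmetric] bilinear_def
  by (auto intro!: linearI simp: vec_eq_iff
      matrix_matrix_mult_def scaleR_sum_right sum.distrib algebra_simps)

lemma bounded_bilinear_matrix_vector_mult:
  "bounded_bilinear ((*v) :: complex^'b^'a \<Rightarrow> complex^'b \<Rightarrow> complex^'a)"
  unfolding bilinear_conv_bounded_bilinear[symmetric] bilinear_def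
  by (auto intro!: linearI simp: vec_eq_iff
      matrix_vector_mult_def scaleR_sum_right sum.distrib algebra_simps)

interpretation matmul: bounded_bilinear "(**) :: complex^'b^'a \<Rightarrow> complex^'c^'b \<Rightarrow> complex^'c^'a"
  by (rule bounded_bilinear_matrix_matrix_mult)

interpretation matvec: bounded_bilinear "(*v) :: complex^'b^'a \<Rightarrow> complex^'b \<Rightarrow> complex^'a"
  by (rule bounded_bilinear_matrix_vector_mult)

text \<open>The type class power on square matrices is the entrywise one.\<close>

definition matpow :: "complex^'m^'m \<Rightarrow> nat \<Rightarrow> complex^'m^'m" where "matpow A m = (((**) A ^^ m) (mat 1))"

lemma matpow_Suc: "matpow A (Suc m) = A ** matpow A m" by (simp add: matpow_def)

lemma matpow_Suc2: "matpow A (Suc m) = matpow A m ** A"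
  by (induction m) (simp_all add: matpow_def matrix_mul_assoc)

lemma matpow_scaleR: "matpow (t *\<^sub>R A) m = t^m *\<^sub>R matpow (A::complex^'m^'m) m"
  by (induction m) (simp_all add: matpow_def matmul.scaleR_left matmul.scaleR_right)

text \<open>The norm of matrices is submultiplicative only up to a constant, so the series is compared
  with an exponential series whose base carries that constant.\<close>

lemma summable_mexp_norm:
  fixes A :: "complex^'m^'m"
  shows "summable (\<lambda>m. norm (inverse (fact m) *\<^sub>R matpow A m))"
proof -
  obtain K where K: "K \<ge> 0" "\<And>(X::complex^'m^'m) (Y::complex^'m^'m). norm (X ** Y) \<le> norm X * norm Y * K"
    using matmul.nonneg_bounded by blast
  have bd: "norm (matpow A m) \<le> (norm A * K)^m * norm (mat 1 :: complex^'m^'m)" for m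
  proof (induction m)
    case (Suc m)
    have "norm (matpow A (Suc m)) \<le> norm A * norm (matpow A m) * K"
      unfolding matpow_Suc using K by blast
    also have "\<dots> \<le> norm A * ((norm A * K)^m * norm (mat 1 :: complex^'m^'m)) * K"
      using Suc K by (intro mult_mono) auto
    finally show ?case by (simp add: algebra_simps)
  qed (simp add: matpow_def)
  have "summable (\<lambda>m. (inverse (fact m) * (norm A * K)^m) * norm (mat 1 :: complex^'m^'m))"
    by (intro summable_mult2 summable_exp)
  then show ?thesis
  proof (rule summable_comparison_test'[where N=0])
    fix m show "norm (norm (inverse (fact m) *\<^sub>R matpow A m)) \<le> (inverse (fact m) * (norm A * K)^m) * norm (mat 1 :: complex^'m^'m)"
      using bd[of m] by (simp add: mult.assoc mult_left_mono)
  qed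
qed

lemma mexp_sums: "(\<lambda>m. inverse (fact m) *\<^sub>R matpow A m) sums mexp A"
  unfolding mexp_def matpow_def[symmetric]
  by (rule summable_sums[OF summable_norm_cancel[OF summable_mexp_norm]])

lemma mexp_commute: "A ** mexp A = mexp A ** A"
proof -
  have "(\<lambda>m. A ** (inverse (fact m) *\<^sub>R matpow A m)) sums (A ** mexp A)"
    by (rule bounded_linear.sums[OF matmul.bounded_linear_right mexp_sums])
  moreover have "(\<lambda>m. (inverse (fact m) *\<^sub>R matpow A m) ** A) sums (mexp A ** A)"
    by (rule bounded_linear.sums[OF matmul.bounded_linear_left mexp_sums])
  moreover have "A ** (inverse (fact m) *\<^sub>R matpow A m) = (inverse (fact m) *\<^sub>R matpow A m) ** A" for m
    by (simp add: matmul.scaleR_left matmul.scaleR_right flip: matpow_Suc matpow_Suc2)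
  ultimately show ?thesis by (simp add: sums_unique2)
qed

lemma mexp_scaleR_sums: "(\<lambda>m. t ^ m *\<^sub>R (inverse (fact m) *\<^sub>R matpow A m)) sums mexp (t *\<^sub>R A)"
  using mexp_sums[of "t *\<^sub>R A"] by (simp add: matpow_scaleR mult.commute)

text \<open>Each coordinate of $t \mapsto e^{tA}$ is a scalar power series that converges everywhere and
  can be differentiated term by term.\<close>

lemma has_vector_derivative_mexp_at:
  fixes A :: "complex^'m^'m"
  shows "((\<lambda>t. mexp (t *\<^sub>R A)) has_vector_derivative A ** mexp (t *\<^sub>R A)) (at t)"
proof -
  have "((\<lambda>t. mexp (t *\<^sub>R A) \<bullet> b) has_real_derivative (A ** mexp (t *\<^sub>R A)) \<bullet> b) (at t)" for b
  proof -
    define c where "c m = inverse (fact m) * (matpow A m \<bullet> b)" for m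
    have s: "(\<lambda>m. c m * t ^ m) sums (mexp (t *\<^sub>R A) \<bullet> b)" for t
      using bounded_linear.sums[OF bounded_linear_inner_left[of b] mexp_scaleR_sums[of t A]]
      by (simp add: c_def mult_ac)
    have "(\<lambda>m. (A ** (t ^ m *\<^sub>R (inverse (fact m) *\<^sub>R matpow A m))) \<bullet> b) sums ((A ** mexp (t *\<^sub>R A)) \<bullet> b)"
      by (intro bounded_linear.sums[OF bounded_linear_inner_left]
          bounded_linear.sums[OF matmul.bounded_linear_right] mexp_scaleR_sums)
    moreover have "(A ** (t ^ m *\<^sub>R (inverse (fact m) *\<^sub>R matpow A m))) \<bullet> b = diffs c m * t ^ m" for m
      by (simp add: diffs_def c_def matmul.scaleR_right matpow_Suc field_simps del: of_nat_Suc)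
    ultimately have "(\<lambda>m. diffs c m * t ^ m) sums ((A ** mexp (t *\<^sub>R A)) \<bullet> b)" by simp
    moreover have "((\<lambda>t. \<Sum>m. c m * t ^ m) has_real_derivative (\<Sum>m. diffs c m * t ^ m)) (at t)"
      by (rule termdiffs_strong'[where K = "norm t + 1"]) (use s sums_summable in auto)
    ultimately show ?thesis using s by (simp add: sums_iff)
  qed
  then show ?thesis
    unfolding has_vector_derivative_def
    by (subst has_derivative_componentwise_within)
       (auto simp: has_real_derivative_iff_has_vector_derivative has_vector_derivative_def inner_commute)
qed

lemmas has_vector_derivative_mexp = has_vector_derivative_mexp_at[THEN has_vector_derivative_at_within]

lemma mexp_0 [simp]: "mexp (0::complex^'m^'m) = mat 1"
proof -
  have "(\<lambda>m. inverse (fact m) *\<^sub>R matpow (0::complex^'m^'m) m) = (\<lambda>m. if m = 0 then mat 1 else 0)"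
    by (auto simp: matpow_def fun_eq_iff gr0_conv_Suc matmul.zero_left)
  with mexp_sums[of "0::complex^'m^'m"] sums_single[of 0 "\<lambda>_. mat 1 :: complex^'m^'m"] show ?thesis
    by (simp add: sums_unique2)
qed

lemma has_vector_derivative_mexp':
  fixes A :: "complex^'m^'m"
  shows "((\<lambda>t. mexp (t *\<^sub>R A)) has_vector_derivative mexp (t *\<^sub>R A) ** A) (at t within S)"
proof -
  have "A ** mexp (t *\<^sub>R A) = mexp (t *\<^sub>R A) ** A"
  proof (cases "t = 0")
    case False
    then show ?thesis
      using mexp_commute[of "t *\<^sub>R A"] by (simp add: matmul.scaleR_left matmul.scaleR_right)
  qed simp
  with has_vector_derivative_mexp[of A t S] show ?thesis by simp
qed

lemma has_vector_derivative_mexp_minus: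
  fixes A :: "complex^'m^'m"
  shows "((\<lambda>t. mexp ((- t) *\<^sub>R A)) has_vector_derivative - (mexp ((- t) *\<^sub>R A) ** A)) (at t within S)"
  using has_vector_derivative_mexp'[of "- A" t S] by (simp add: matmul.minus_right)

lemma continuous_on_mexp:
  "continuous_on S (\<lambda>t. mexp (t *\<^sub>R A))"
  by (rule continuous_at_imp_continuous_on) (use has_vector_derivative_continuous[OF has_vector_derivative_mexp] in blast)

lemma continuous_on_mexp_shift: "continuous_on S (\<lambda>y. mexp ((y - c) *\<^sub>R A))"
  by (rule continuous_on_compose2[OF continuous_on_mexp[of UNIV A]]) (auto intro!: continuous_intros)

lemma continuous_on_mexp_neg: "continuous_on S (\<lambda>y. mexp ((- y) *\<^sub>R A))"
  by (rule continuous_on_compose2[OF continuous_on_mexp[of UNIV A]]) (auto intro!: continuous_intros)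

lemma has_vector_derivative_zero_const:
  assumes "\<And>t::real. (f has_vector_derivative 0) (at t)"
  shows "f t = f s"
  using has_vector_derivative_zero_constant[of UNIV f] assms by (metis UNIV_I convex_UNIV)

lemma mexp_minus_mult: "mexp ((- t) *\<^sub>R A) ** mexp (t *\<^sub>R A) = mat 1"
proof -
  have "((\<lambda>t. mexp ((- t) *\<^sub>R A) ** mexp (t *\<^sub>R A)) has_vector_derivative 0) (at t)" for t
    by (rule has_vector_derivative_eq_rhs[OF matmul.has_vector_derivative
          [OF has_vector_derivative_mexp_minus has_vector_derivative_mexp]])
       (simp add: matmul.minus_left matrix_mul_assoc)
  from has_vector_derivative_zero_const[OF this, of t 0] show ?thesis by simp
qed

lemma mexp_mult_minus: "mexp (t *\<^sub>R A) ** mexp ((- t) *\<^sub>R A) = mat 1"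
  using mexp_minus_mult[of "-t" A] by simp

text \<open>The derivative of $e^{-tA}X(t)$ vanishes. Identities between exponentials (semigroup law,
  adjoints, block diagonal matrices) are proved below by checking that both sides solve the same
  initial value problem.\<close>

lemma linear_ode_unique:
  fixes X :: "real \<Rightarrow> complex^'c^'m"
  assumes "\<And>t. (X has_vector_derivative A ** X t) (at t)"
  shows "X t = mexp (t *\<^sub>R A) ** X 0"
proof -
  have "((\<lambda>t. mexp ((- t) *\<^sub>R A) ** X t) has_vector_derivative 0) (at t)" for t
    by (rule has_vector_derivative_eq_rhs[OF matmul.has_vector_derivative
          [OF has_vector_derivative_mexp_minus assms]])
       (simp add: matmul.minus_left matrix_mul_assoc)
  from has_vector_derivative_zero_const[OF this, of t 0]
  have "mexp ((- t) *\<^sub>R A) ** X t = X 0" by simp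
  then have "mexp (t *\<^sub>R A) ** (mexp ((- t) *\<^sub>R A) ** X t) = mexp (t *\<^sub>R A) ** X 0" by simp
  then show ?thesis by (simp only: matrix_mul_assoc mexp_mult_minus matrix_mul_lid)
qed

lemma mexp_add: "mexp ((s + t) *\<^sub>R A) = mexp (s *\<^sub>R A) ** mexp (t *\<^sub>R A)"
proof -
  have "((\<lambda>s. mexp ((s + t) *\<^sub>R A)) has_vector_derivative A ** mexp ((s + t) *\<^sub>R A)) (at s)" for s
  proof -
    have "((\<lambda>s. s + t) has_vector_derivative 1) (at s)"
      by (auto intro!: derivative_eq_intros simp flip: has_real_derivative_iff_has_vector_derivative)
    from vector_diff_chain_at[OF this has_vector_derivative_mexp_at[of A "s + t"]]
    show ?thesis by (simp add: o_def)
  qed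
  from linear_ode_unique[OF this, of s] show ?thesis by simp
qed

lemma cadj_mult: "cadj (A ** B) = cadj B ** cadj A"
  by (simp add: cadj_def matrix_matrix_mult_def vec_eq_iff mult.commute)

lemma cadj_cadj [simp]: "cadj (cadj A) = A" by (simp add: cadj_def vec_eq_iff)

lemma cadj_mat1 [simp]: "cadj (mat 1) = mat 1" by (simp add: cadj_def vec_eq_iff mat_def)

lemma cadj_minus: "cadj (- A) = - cadj A" by (simp add: cadj_def vec_eq_iff)

lemma cadj_add: "cadj (A + B) = cadj A + cadj B" by (simp add: cadj_def vec_eq_iff)

lemma bounded_linear_cadj: "bounded_linear (cadj :: complex^'c^'r \<Rightarrow> _)"
  unfolding linear_conv_bounded_linear[symmetric]
  by (auto intro!: linearI simp: cadj_def vec_eq_iff)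

lemma mexp_cadj: "cadj (mexp (t *\<^sub>R A)) = mexp (t *\<^sub>R cadj A)"
proof -
  have "((\<lambda>t. cadj (mexp (t *\<^sub>R A))) has_vector_derivative cadj A ** cadj (mexp (t *\<^sub>R A))) (at t)" for t
    using bounded_linear.has_vector_derivative[OF bounded_linear_cadj has_vector_derivative_mexp'[of A t UNIV]]
    by (simp add: cadj_mult)
  from linear_ode_unique[OF this, of t] show ?thesis by simp
qed

lemma cscale_real: "cscale (c * of_real x) A = x *\<^sub>R cscale c A"
  unfolding cscale_def by (auto simp: vec_eq_iff) (simp add: scaleR_conv_of_real mult_ac)

lemma cadj_cscale: "cadj (cscale c A) = cscale (cnj c) (cadj A)"
  by (simp add: cscale_def cadj_def vec_eq_iff)

lemma cscale_minus: "cscale (- c) A = - cscale c A"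
  by (simp add: cscale_def vec_eq_iff)

lemma diagm_mult_entry: "(diagm u ** A) $ i $ j = u i * A $ i $ j"
  by (simp add: diagm_def matrix_matrix_mult_def if_distrib if_distribR sum.delta cong: if_cong)

lemma mult_diagm_entry: "(A ** diagm u) $ i $ j = A $ i $ j * u j"
  by (simp add: diagm_def matrix_matrix_mult_def if_distrib if_distribR sum.delta cong: if_cong)

lemma diagm_mult: "diagm u ** diagm v = diagm (\<lambda>i. u i * v i)"
  unfolding vec_eq_iff diagm_mult_entry by (simp add: diagm_def)

lemma diagm_1: "diagm (\<lambda>_. 1) = mat 1" by (simp add: diagm_def mat_def)

lemma cadj_diagm: "cadj (diagm u) = diagm (\<lambda>i. cnj (u i))"
  by (auto simp: diagm_def cadj_def vec_eq_iff)

lemma matrix_inv_eqI: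
  fixes A B :: "complex^'n^'n"
  assumes "B ** A = mat 1" shows "matrix_inv A = B"
proof -
  have AB: "A ** B = mat 1" using assms by (simp add: matrix_left_right_inverse)
  have "A ** matrix_inv A = mat 1 \<and> matrix_inv A ** A = mat 1"
    unfolding matrix_inv_def by (rule someI[of _ B]) (use assms AB in simp)
  then have "B ** (A ** matrix_inv A) = B" by simp
  then show ?thesis using assms by (simp add: matrix_mul_assoc)
qed

lemma det_nonzero_matrix_inv:
  fixes A :: "complex^'n^'n"
  assumes "det A \<noteq> 0" shows "A ** matrix_inv A = mat 1" "matrix_inv A ** A = mat 1"
  using assms invertible_det_nz[of A] someI_ex[of "\<lambda>B. A ** B = mat 1 \<and> B ** A = mat 1"]
  unfolding matrix_inv_def invertible_def by auto

section \<open>Block matrices\<close>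

lemma sum_UNIV_sum_type: "(\<Sum>x\<in>(UNIV :: ('a::finite + 'b::finite) set). f x) = (\<Sum>x\<in>UNIV. f (Inl x)) + (\<Sum>x\<in>UNIV. f (Inr x))"
  by (simp add: UNIV_Plus_UNIV[symmetric] sum.Plus del: UNIV_Plus_UNIV)

lemma all_sum_type: "(\<forall>x::'a + 'b. P x) \<longleftrightarrow> (\<forall>x. P (Inl x)) \<and> (\<forall>x. P (Inr x))"
  by (metis obj_sumE)

lemma block_mult:
  "block A B C D ** block E F G H =
     block (A ** E + B ** G) (A ** F + B ** H) (C ** E + D ** G) (C ** F + D ** H)"
  by (simp add: vec_eq_iff all_sum_type block_def vstack_def hstack_def matrix_matrix_mult_def sum_UNIV_sum_type)

lemma block_vstack: "block A B C D ** vstack E F = vstack (A ** E + B ** F) (C ** E + D ** F)"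
  by (simp add: vec_eq_iff all_sum_type block_def vstack_def hstack_def matrix_matrix_mult_def sum_UNIV_sum_type)

lemma hstack_vstack: "hstack A B ** vstack E F = A ** E + B ** F"
  by (simp add: vec_eq_iff all_sum_type block_def vstack_def hstack_def matrix_matrix_mult_def sum_UNIV_sum_type)

lemma hstack_block: "hstack A B ** block E F G H = hstack (A ** E + B ** G) (A ** F + B ** H)"
  by (simp add: vec_eq_iff all_sum_type block_def vstack_def hstack_def matrix_matrix_mult_def sum_UNIV_sum_type)

lemma mat1_block: "mat 1 = block (mat 1) 0 0 (mat 1)"
  by (simp add: vec_eq_iff all_sum_type block_def vstack_def hstack_def mat_def)

lemma block_zero: "block 0 0 0 0 = 0"
  by (simp add: vec_eq_iff all_sum_type block_def vstack_def hstack_def)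

lemma block_add: "block A B C D + block E F G H = block (A+E) (B+F) (C+G) (D+H)"
  by (simp add: vec_eq_iff all_sum_type block_def vstack_def hstack_def)

lemma cadj_block: "cadj (block A B C D) = block (cadj A) (cadj C) (cadj B) (cadj D)"
  by (simp add: vec_eq_iff all_sum_type block_def vstack_def hstack_def cadj_def)

lemma cadj_vstack: "cadj (vstack A B) = hstack (cadj A) (cadj B)"
  by (simp add: vec_eq_iff all_sum_type block_def vstack_def hstack_def cadj_def)

lemma block_decomp: "M = block (\<chi> i j. M $ Inl i $ Inl j) (\<chi> i j. M $ Inl i $ Inr j) (block21 M) (block22 M)"
  by (simp add: vec_eq_iff all_sum_type block_def vstack_def hstack_def block21_def block22_def)

lemma mexp_block_diag:
  fixes A :: "complex^'a^'a" and B :: "complex^'b^'b"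
  shows "mexp (t *\<^sub>R block A 0 0 B) = block (mexp (t *\<^sub>R A)) 0 0 (mexp (t *\<^sub>R B))"
proof -
  let ?X = "\<lambda>t. block (mexp (t *\<^sub>R A)) 0 0 (mexp (t *\<^sub>R B))"
  have L: "bounded_linear (\<lambda>X :: complex^'a^'a. block X 0 0 0 :: complex^('a+'b)^('a+'b))"
    unfolding linear_conv_bounded_linear[symmetric]
    by (auto intro!: linearI simp: vec_eq_iff all_sum_type block_def vstack_def hstack_def)
  have R: "bounded_linear (\<lambda>X :: complex^'b^'b. block 0 0 0 X :: complex^('a+'b)^('a+'b))"
    unfolding linear_conv_bounded_linear[symmetric]
    by (auto intro!: linearI simp: vec_eq_iff all_sum_type block_def vstack_def hstack_def)
  have "(?X has_vector_derivative block A 0 0 B ** ?X t) (at t)" for t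
    using has_vector_derivative_add[OF bounded_linear.has_vector_derivative[OF L has_vector_derivative_mexp_at[of A t]]
       bounded_linear.has_vector_derivative[OF R has_vector_derivative_mexp_at[of B t]]]
    by (simp add: block_add block_mult)
  from linear_ode_unique[OF this, of t] show ?thesis by (simp add: mat1_block[symmetric])
qed

lemma AA_block: "AA \<beta> = block (cscale \<i> (cadj \<beta>)) 0 0 (cscale \<i> \<beta>)"
  by (simp add: AA_def vec_eq_iff all_sum_type cscale_def block_def vstack_def hstack_def)

section \<open>J-unitary matrices\<close>

lemma JJ_square: "JJ ** JJ = - mat 1"
  by (simp add: JJ_def block_mult mat1_block matmul.minus_left matmul.minus_right)
     (simp add: vec_eq_iff all_sum_type block_def vstack_def hstack_def)

definition J_unitary :: "complex^('n::finite + 'n)^('n + 'n) \<Rightarrow> bool" where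
  "J_unitary X \<longleftrightarrow> cadj X ** JJ ** X = JJ"

text \<open>The infinitesimal version of \<^const>\<open>J_unitary\<close>: these matrices form the Lie
  algebra of the \<open>J\<close>-unitary group.\<close>

definition J_skew :: "complex^('n::finite + 'n)^('n + 'n) \<Rightarrow> bool" where
  "J_skew M \<longleftrightarrow> cadj M ** JJ + JJ ** M = 0"

lemma J_unitary_mult:
  assumes "J_unitary X" "J_unitary Y" shows "J_unitary (X ** Y)"
proof -
  have "cadj (X ** Y) ** JJ ** (X ** Y) = cadj Y ** (cadj X ** JJ ** X) ** Y"
    by (simp add: cadj_mult matrix_mul_assoc)
  then show ?thesis using assms by (simp add: J_unitary_def)
qed

text \<open>The function $t \mapsto e^{tM^*}\widetilde J e^{tM}$ has derivative $e^{tM^*}(M^*\widetilde J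
  + \widetilde J M)e^{tM} = 0$.\<close>

lemma J_unitary_mexp:
  assumes "J_skew M" shows "J_unitary (mexp (t *\<^sub>R M))"
proof -
  let ?f = "\<lambda>t. mexp (t *\<^sub>R cadj M) ** (JJ ** mexp (t *\<^sub>R M))"
  have "(?f has_vector_derivative 0) (at t)" for t
  proof (rule has_vector_derivative_eq_rhs[OF matmul.has_vector_derivative
        [OF has_vector_derivative_mexp' bounded_linear.has_vector_derivative[OF matmul.bounded_linear_right has_vector_derivative_mexp]]])
    have "mexp (t *\<^sub>R cadj M) ** (JJ ** (M ** mexp (t *\<^sub>R M))) +
      mexp (t *\<^sub>R cadj M) ** cadj M ** (JJ ** mexp (t *\<^sub>R M)) =
      mexp (t *\<^sub>R cadj M) ** (cadj M ** JJ + JJ ** M) ** mexp (t *\<^sub>R M)"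
      by (simp add: matmul.add_left matmul.add_right matrix_mul_assoc)
    then show "mexp (t *\<^sub>R cadj M) ** (JJ ** (M ** mexp (t *\<^sub>R M))) +
      mexp (t *\<^sub>R cadj M) ** cadj M ** (JJ ** mexp (t *\<^sub>R M)) = 0"
      using assms by (simp add: J_skew_def)
  qed
  from has_vector_derivative_zero_const[OF this, of t 0]
  show ?thesis by (simp add: J_unitary_def mexp_cadj matrix_mul_assoc)
qed

lemma J_skew_AA: "J_skew (AA \<beta>)"
  unfolding J_skew_def AA_block JJ_def cadj_block cadj_cscale
  by (simp add: block_mult block_add cscale_minus matmul.minus_left matmul.minus_right)
     (simp add: vec_eq_iff all_sum_type block_def vstack_def hstack_def cadj_def cscale_def)

text \<open>With $W$ the column of \<open>\<Theta>2\<close> and \<open>\<Theta>1\<close>, multiplication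
  by $\widetilde J$ turns the left factor into $-W$, and the right factor is $W^*$. So
  $\widetilde J$ times the matrix is $-W R W^*$, which is Hermitian, while $\widetilde J^* =
  -\widetilde J$.\<close>

lemma J_skew_perturb:
  assumes "cadj R = R"
  shows "J_skew (vstack (- \<Theta>1) \<Theta>2 ** R ** hstack (cadj \<Theta>2) (cadj \<Theta>1))"
proof -
  let ?v = "vstack (- \<Theta>1) \<Theta>2" and ?W = "vstack \<Theta>2 \<Theta>1" and ?h = "hstack (cadj \<Theta>2) (cadj \<Theta>1)"
  have Jv: "JJ ** ?v = - ?W"
    by (simp add: JJ_def block_vstack matmul.minus_left) (simp add: vec_eq_iff all_sum_type vstack_def)
  have vJ: "cadj ?v ** JJ = cadj ?W"
    by (simp add: JJ_def cadj_vstack hstack_block cadj_minus matmul.minus_left matmul.minus_right)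
  have h: "?h = cadj ?W" by (simp add: cadj_vstack)
  have "cadj (?v ** R ** ?h) ** JJ = cadj ?h ** R ** (cadj ?v ** JJ)"
    by (simp add: cadj_mult assms matrix_mul_assoc)
  moreover have "JJ ** (?v ** R ** ?h) = (JJ ** ?v) ** R ** ?h"
    by (simp add: matrix_mul_assoc)
  ultimately show ?thesis unfolding J_skew_def by (simp add: Jv vJ h matmul.minus_left)
qed

lemma J_skew_add: "J_skew M \<Longrightarrow> J_skew N \<Longrightarrow> J_skew (M + N)"
  unfolding J_skew_def by (simp add: cadj_add matmul.add_left matmul.add_right add_ac)

text \<open>The inverse of a \<open>J\<close>-unitary matrix, as a real-linear expression in it;
  continuity and differentiability pass from a matrix function to its inverse without further
  work.\<close>

definition J_inv :: "complex^('n::finite + 'n)^('n + 'n) \<Rightarrow> complex^('n + 'n)^('n + 'n)" where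
  "J_inv X = - (JJ ** cadj X ** JJ)"

lemma J_inv_left: assumes "J_unitary X" shows "J_inv X ** X = mat 1"
proof -
  have "J_inv X ** X = - (JJ ** (cadj X ** JJ ** X))"
    by (simp add: J_inv_def matmul.minus_left matrix_mul_assoc)
  then show ?thesis using assms by (simp add: J_unitary_def JJ_square)
qed

lemma J_inv_right: "J_unitary X \<Longrightarrow> X ** J_inv X = mat 1"
  using J_inv_left matrix_left_right_inverse by blast

lemma matrix_inv_J: "J_unitary X \<Longrightarrow> matrix_inv X = J_inv X"
  by (rule matrix_inv_eqI[OF J_inv_left])

lemma bounded_linear_J_inv: "bounded_linear J_inv"
  unfolding J_inv_def[abs_def]
  by (intro bounded_linear_minus bounded_linear_compose[OF matmul.bounded_linear_left]
       bounded_linear_compose[OF matmul.bounded_linear_right] bounded_linear_cadj)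

section \<open>The projection attached to a matrix with invertible lower right block\<close>

definition proj1 :: "complex^('n::finite + 'n)^('n + 'n)" where "proj1 = block (mat 1) 0 0 0"

definition proj2 :: "complex^('n::finite + 'n)^('n + 'n)" where "proj2 = block 0 0 0 (mat 1)"

lemma proj_sum: "proj2 + proj1 = mat 1"
  by (simp add: proj1_def proj2_def block_add mat1_block)

lemma proj1_Pcross: "proj1 ** Pcross X = 0"
  by (simp add: proj1_def Pcross_def block_mult block_zero)

lemma compl_Pcross_proj2: "(mat 1 - Pcross X) ** proj2 = 0"
  unfolding matmul.diff_left by (simp add: proj2_def Pcross_def block_mult)

text \<open>The lower block row of $X$ is unchanged by \<^term>\<open>Pcross X\<close>: the projection is
  built from $X_{22}^{-1}X_{21}$ for this purpose.\<close>

lemma proj2_U_compl_Pcross: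
  fixes X :: "complex^('n::finite + 'n)^('n + 'n)"
  assumes "det (block22 X) \<noteq> 0"
  shows "proj2 ** X ** (mat 1 - Pcross X) = 0"
proof -
  let ?B = "block 0 0 (block21 X) (block22 X) :: complex^('n + 'n)^('n + 'n)"
  have "proj2 ** X = ?B"
    by (subst (1) block_decomp[of X]) (simp add: proj2_def block_mult)
  moreover have "?B ** Pcross X = ?B"
    using det_nonzero_matrix_inv(1)[OF assms] by (simp add: Pcross_def block_mult matrix_mul_assoc)
  ultimately show ?thesis by (simp add: matmul.diff_right)
qed

text \<open>\<^term>\<open>Pcross X\<close> is $X_{22}^{-1}$ times the lower block row of $X$, so
  multiplying by the inverse of $X$ leaves only the block $X_{22}^{-1}$.\<close>

lemma Pcross_inv_proj1:
  assumes "det (block22 X) \<noteq> 0" "X ** Y = mat 1"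
  shows "Pcross X ** Y ** proj1 = 0"
proof -
  let ?W = "block 0 0 0 (matrix_inv (block22 X))"
  have "?W ** X = Pcross X"
    using det_nonzero_matrix_inv(2)[OF assms(1)]
    by (subst (2) block_decomp[of X]) (simp add: Pcross_def block_mult)
  then have "Pcross X ** Y = ?W ** (X ** Y)" by (simp add: matrix_mul_assoc)
  then have "Pcross X ** Y = ?W" by (simp add: assms(2))
  then show ?thesis by (simp add: proj1_def block_mult block_zero)
qed

section \<open>Square integrable functions and integral operators with bounded kernels\<close>

abbreviation "leb l \<equiv> lebesgue_on {0<..<l::real}"

lemma finite_measure_leb: "finite_measure (leb l)"
  by (rule finite_measure_lebesgue_on) (simp add: bounded_set_imp_lmeasurable)

lemma measurable_id_leb: "(\<lambda>x. x) \<in> borel_measurable (leb l)"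
  by (intro measurable_restrict_space1 measurable_completion) simp

lemma measurable_fst_leb: "fst \<in> borel_measurable (leb l \<Otimes>\<^sub>M leb l')"
  using measurable_compose[of fst _ "leb l" "\<lambda>x. x" borel, OF measurable_fst measurable_id_leb] .

lemma measurable_snd_leb: "snd \<in> borel_measurable (leb l' \<Otimes>\<^sub>M leb l)"
  using measurable_compose[of snd _ "leb l" "\<lambda>x. x" borel, OF measurable_snd measurable_id_leb] .

lemma AE_leb_I: "(\<And>x. x \<in> {0<..<l} \<Longrightarrow> P x) \<Longrightarrow> AE x in leb l. P x"
  by (rule AE_I2) (simp add: space_restrict_space)

lemma AE_leb_iff: "(AE x in leb l. P x) \<longleftrightarrow> (AE x in lebesgue. 0 < x \<and> x < l \<longrightarrow> P x)"
  by (subst AE_restrict_space_iff) auto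

lemma measurable_vec:
  fixes f :: "'a \<Rightarrow> 'b::euclidean_space^'n"
  assumes "\<And>i. (\<lambda>x. f x $ i) \<in> borel_measurable M"
  shows "f \<in> borel_measurable M"
proof (subst borel_measurable_euclidean_space, rule ballI)
  fix b :: "'b^'n" assume "b \<in> Basis"
  then obtain i c where b: "b = axis i c" "c \<in> Basis" by (auto simp: Basis_vec_def)
  have "(\<lambda>x. f x $ i \<bullet> c) \<in> borel_measurable M" using assms[of i] by simp
  then show "(\<lambda>x. f x \<bullet> b) \<in> borel_measurable M" by (simp add: b inner_axis)
qed

lemma measurable_vec_nth:
  fixes f :: "'a \<Rightarrow> 'b::euclidean_space^'n"
  assumes "f \<in> borel_measurable M"
  shows "(\<lambda>x. f x $ i) \<in> borel_measurable M"
  using assms by (rule borel_measurable_continuous_on[rotated]) (intro continuous_intros)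

lemma measurable_matrix_vector_mult [measurable (raw)]:
  fixes A :: "'a \<Rightarrow> complex^'q^'p"
  assumes "A \<in> borel_measurable M" "v \<in> borel_measurable M"
  shows "(\<lambda>x. A x *v v x) \<in> borel_measurable M"
  by (rule borel_measurable_continuous_Pair[OF assms]) (intro matvec.continuous_on continuous_intros)

lemma measurable_matrix_matrix_mult [measurable (raw)]:
  fixes A :: "'a \<Rightarrow> complex^'q^'p"
  assumes "A \<in> borel_measurable M" "B \<in> borel_measurable M"
  shows "(\<lambda>x. A x ** B x) \<in> borel_measurable M"
  by (rule borel_measurable_continuous_Pair[OF assms]) (intro matmul.continuous_on continuous_intros)

lemma L2_measurable: "f \<in> L2 l \<Longrightarrow> f \<in> borel_measurable (leb l)"
  by (simp add: L2_def)

lemma L2_square_integrable: "f \<in> L2 l \<Longrightarrow> integrable (leb l) (\<lambda>x. (norm (f x))\<^sup>2)"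
  by (simp add: L2_def)

lemma L2_integrable:
  assumes "f \<in> L2 l" shows "integrable (leb l) f"
proof -
  interpret finite_measure "leb l" by (rule finite_measure_leb)
  have "integrable (leb l) (\<lambda>x. 1 + (norm (f x))\<^sup>2)"
    using L2_square_integrable[OF assms] by simp
  then show ?thesis
  proof (rule Bochner_Integration.integrable_bound[OF _ L2_measurable[OF assms] AE_I2])
    fix x
    have "0 \<le> (norm (f x) - 1)\<^sup>2 + norm (f x)^2 + 1" by simp
    then show "norm (f x) \<le> norm (1 + (norm (f x))\<^sup>2)"
      by (simp add: power2_eq_square algebra_simps)
  qed
qed

lemma L2_add: assumes "f \<in> L2 l" "g \<in> L2 l" shows "(\<lambda>x. f x + g x) \<in> L2 l"
proof -
  note [measurable] = assms[THEN L2_measurable]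
  have "integrable (leb l) (\<lambda>x. 2 * (norm (f x))\<^sup>2 + 2 * (norm (g x))\<^sup>2)"
    using assms[THEN L2_square_integrable] by simp
  then have "integrable (leb l) (\<lambda>x. (norm (f x + g x))\<^sup>2)"
  proof (rule Bochner_Integration.integrable_bound[OF _ _ AE_I2])
    fix x
    have "(norm (f x + g x))\<^sup>2 \<le> (norm (f x) + norm (g x))\<^sup>2"
      by (intro power_mono norm_triangle_ineq) auto
    also have "\<dots> \<le> 2 * (norm (f x))\<^sup>2 + 2 * (norm (g x))\<^sup>2"
      using sum_squares_bound[of "norm (f x)" "norm (g x)"] by (simp add: power2_sum)
    finally show "norm ((norm (f x + g x))\<^sup>2) \<le> norm (2 * (norm (f x))\<^sup>2 + 2 * (norm (g x))\<^sup>2)" by simp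
  qed measurable
  then show ?thesis unfolding L2_def by simp
qed

lemma norm_vector_smult: "norm (c *s (v::complex^'p)) = norm c * norm v"
  by (simp add: norm_vec_def L2_set_right_distrib norm_mult)

lemma bounded_linear_vector_smult: "bounded_linear (\<lambda>v::complex^'p. c *s v)"
  unfolding linear_conv_bounded_linear[symmetric]
  by (auto intro!: linearI simp: vec_eq_iff algebra_simps)

lemma L2_smult: assumes "f \<in> L2 l" shows "(\<lambda>x. c *s f x) \<in> L2 l"
proof -
  note [measurable] = assms[THEN L2_measurable]
  have "(\<lambda>x. c *s f x) \<in> borel_measurable (leb l)"
    by (rule borel_measurable_continuous_on[OF _ L2_measurable[OF assms]])
       (rule linear_continuous_on[OF bounded_linear_vector_smult])
  then show ?thesis using assms
    unfolding L2_def by (simp add: norm_vector_smult power_mult_distrib)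
qed

lemma L2_bounded:
  assumes "g \<in> borel_measurable (leb l)" "\<And>x. x \<in> {0<..<l} \<Longrightarrow> norm (g x) \<le> c"
  shows "g \<in> L2 l"
proof -
  interpret finite_measure "leb l" by (rule finite_measure_leb)
  note [measurable] = assms(1)
  have "integrable (leb l) (\<lambda>x. (norm (g x))\<^sup>2)"
  proof (rule integrable_const_bound[where B = "c\<^sup>2", OF AE_I2])
    fix x assume "x \<in> space (leb l)"
    then show "norm ((norm (g x))\<^sup>2) \<le> c\<^sup>2"
      using assms(2)[of x] by (auto simp: space_restrict_space intro: power_mono)
  qed measurable
  then show ?thesis using assms unfolding L2_def by simp
qed

lemma L2_cong:
  assumes "\<And>x. x \<in> {0<..<l} \<Longrightarrow> f x = g x" "g \<in> L2 l" shows "f \<in> L2 l"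
proof -
  have "f \<in> borel_measurable (leb l) \<longleftrightarrow> g \<in> borel_measurable (leb l)"
    by (rule measurable_cong) (simp add: assms space_restrict_space)
  moreover have "integrable (leb l) (\<lambda>x. (norm (f x))\<^sup>2) \<longleftrightarrow> integrable (leb l) (\<lambda>x. (norm (g x))\<^sup>2)"
    by (rule Bochner_Integration.integrable_cong) (simp_all add: assms space_restrict_space)
  ultimately show ?thesis using assms(2) unfolding L2_def by simp
qed

lemma ae_eq_sym: "ae_eq l f g \<Longrightarrow> ae_eq l g f"
  unfolding ae_eq_def by (erule AE_mp) simp

lemma ae_eq_trans: "ae_eq l f g \<Longrightarrow> ae_eq l g h \<Longrightarrow> ae_eq l f h"
  unfolding ae_eq_def by (erule AE_mp, erule AE_mp) simp

lemma L2norm_cong: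
  assumes "f \<in> L2 l" "g \<in> L2 l" "ae_eq l f g" shows "L2norm l f = L2norm l g"
proof -
  have "(LINT x|leb l. (norm (f x))\<^sup>2) = (LINT x|leb l. (norm (g x))\<^sup>2)"
    using assms L2_square_integrable[of f l] L2_square_integrable[of g l] unfolding ae_eq_def
    by (intro integral_cong_AE) auto
  then show ?thesis by (simp add: L2norm_def)
qed

text \<open>Cauchy-Schwarz on an interval of length $l$: integrate $(|f| - c)^2 \ge 0$ with $c$ the mean
  value of $|f|$.\<close>

lemma integral_norm_le_L2norm:
  assumes "f \<in> L2 l" "0 < l"
  shows "(LINT x|leb l. norm (f x)) \<le> sqrt l * L2norm l f"
proof -
  interpret finite_measure "leb l" by (rule finite_measure_leb)
  define I where "I = (LINT x|leb l. norm (f x))"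
  define c where "c = I / l"
  have m: "measure (leb l) (space (leb l)) = l"
    using assms by (simp add: space_restrict_space measure_restrict_space)
  have i: "integrable (leb l) (\<lambda>x. norm (f x))" "integrable (leb l) (\<lambda>x. (norm (f x))\<^sup>2)"
    using L2_integrable[OF assms(1)] L2_square_integrable[OF assms(1)] by auto
  have "0 \<le> (LINT x|leb l. (norm (f x) - c)\<^sup>2)" by simp
  also have "\<dots> = (LINT x|leb l. (norm (f x))\<^sup>2 - 2 * c * norm (f x) + c\<^sup>2)"
    by (simp add: power2_diff algebra_simps)
  also have "\<dots> = (LINT x|leb l. (norm (f x))\<^sup>2) - 2 * c * I + c\<^sup>2 * l"
    using i m by (simp add: I_def)
  also have "\<dots> = (LINT x|leb l. (norm (f x))\<^sup>2) - I\<^sup>2 / l"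
    using assms by (simp add: c_def field_simps power2_eq_square)
  finally have "I\<^sup>2 \<le> l * (LINT x|leb l. (norm (f x))\<^sup>2)"
    using assms by (simp add: field_simps)
  from real_le_rsqrt[OF this] show ?thesis by (simp add: I_def L2norm_def real_sqrt_mult)
qed

text \<open>Measurability is required on the whole plane, so that it passes to dilated kernels.\<close>

definition bounded_kernel :: "real \<Rightarrow> (real \<Rightarrow> real \<Rightarrow> complex^'q^'p) \<Rightarrow> bool" where
  "bounded_kernel l N \<longleftrightarrow> (\<lambda>z. N (fst z) (snd z)) \<in> borel_measurable borel \<and>
     (\<exists>c. \<forall>x\<in>{0<..<l}. \<forall>t\<in>{0<..<l}. norm (N x t) \<le> c)"

definition kernel_op :: "real \<Rightarrow> (real \<Rightarrow> real \<Rightarrow> complex^'p^'p) \<Rightarrow> (real \<Rightarrow> complex^'p) \<Rightarrow> real \<Rightarrow> complex^'p" where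
 "kernel_op l N f x = f x + (LINT t|leb l. N x t *v f t)"

lemma bounded_kernel_measurable:
  assumes "bounded_kernel l N" "f \<in> measurable M borel" "g \<in> measurable M borel"
  shows "(\<lambda>x. N (f x) (g x)) \<in> borel_measurable M"
proof -
  have "(\<lambda>x. (f x, g x)) \<in> measurable M borel"
    using assms(2,3) by (simp add: borel_prod[symmetric])
  moreover have "(\<lambda>z. N (fst z) (snd z)) \<in> borel_measurable borel"
    using assms(1) by (simp add: bounded_kernel_def)
  ultimately show ?thesis
    using measurable_compose[of "\<lambda>x. (f x, g x)" M borel "\<lambda>z. N (fst z) (snd z)" borel] by simp
qed

lemma kernel_norm_bound:
  fixes N :: "real \<Rightarrow> real \<Rightarrow> complex^'q^'p"
  assumes "bounded_kernel l N"
  shows "\<exists>c\<ge>0. \<forall>x\<in>{0<..<l}. \<forall>t\<in>{0<..<l}. \<forall>v. norm (N x t *v v) \<le> c * norm v"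
proof -
  obtain c0 where c0: "\<And>x t. x \<in> {0<..<l} \<Longrightarrow> t \<in> {0<..<l} \<Longrightarrow> norm (N x t) \<le> c0"
    using assms unfolding bounded_kernel_def by blast
  obtain K where K: "K \<ge> 0" "\<And>(X::complex^'q^'p) v. norm (X *v v) \<le> norm X * norm v * K"
    using matvec.nonneg_bounded by blast
  show ?thesis
  proof (intro exI[of _ "\<bar>c0\<bar> * K"] conjI ballI allI)
    fix x t v assume "x \<in> {0<..<l}" "t \<in> {0<..<l}"
    have "norm (N x t *v v) \<le> norm (N x t) * norm v * K" by (rule K)
    also have "\<dots> \<le> \<bar>c0\<bar> * norm v * K"
      using c0[of x t] \<open>x \<in> _\<close> \<open>t \<in> _\<close> K(1) by (intro mult_right_mono) auto
    finally show "norm (N x t *v v) \<le> \<bar>c0\<bar> * K * norm v" by (simp only: mult_ac)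
  qed (use K in auto)
qed

lemma kernel_integrable:
  fixes N :: "real \<Rightarrow> real \<Rightarrow> complex^'q^'p"
  assumes N: "bounded_kernel l N" and f: "integrable (leb l) f" and x: "x \<in> {0<..<l}"
  shows "integrable (leb l) (\<lambda>t. N x t *v f t)"
proof -
  obtain c where c: "c \<ge> 0" "\<And>x t v. x \<in> {0<..<l} \<Longrightarrow> t \<in> {0<..<l} \<Longrightarrow> norm (N x t *v v) \<le> c * norm v"
    using kernel_norm_bound[OF N] by blast
  have "integrable (leb l) (\<lambda>t. c * norm (f t))" using f by simp
  then show ?thesis
  proof (rule Bochner_Integration.integrable_bound[OF _ _ AE_I2])
    fix t assume "t \<in> space (leb l)"
    then have "norm (N x t *v f t) \<le> c * norm (f t)" using c(2)[OF x] by (simp add: space_restrict_space)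
    then show "norm (N x t *v f t) \<le> norm (c * norm (f t))" using c(1) by simp
  next
    have "N x \<in> borel_measurable (leb l)"
      by (rule bounded_kernel_measurable[OF N measurable_const measurable_id_leb]) simp
    then show "(\<lambda>t. N x t *v f t) \<in> borel_measurable (leb l)"
      using f by (intro measurable_matrix_vector_mult) auto
  qed
qed

lemma kernel_integral_bound:
  fixes N :: "real \<Rightarrow> real \<Rightarrow> complex^'q^'p"
  assumes N: "bounded_kernel l N"
  shows "\<exists>c\<ge>0. \<forall>f. integrable (leb l) f \<longrightarrow> (\<forall>x\<in>{0<..<l}.
    norm (LINT t|leb l. N x t *v f t) \<le> c * (LINT t|leb l. norm (f t)))"
proof -
  obtain c where c: "c \<ge> 0" "\<And>x t v. x \<in> {0<..<l} \<Longrightarrow> t \<in> {0<..<l} \<Longrightarrow> norm (N x t *v v) \<le> c * norm v"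
    using kernel_norm_bound[OF N] by blast
  show ?thesis
  proof (intro exI[of _ c] conjI allI impI ballI)
    fix f :: "real \<Rightarrow> complex^'q" and x assume f: "integrable (leb l) f" and x: "x \<in> {0<..<l}"
    have "norm (LINT t|leb l. N x t *v f t) \<le> (LINT t|leb l. norm (N x t *v f t))"
      by (rule integral_norm_bound)
    also have "\<dots> \<le> (LINT t|leb l. c * norm (f t))"
      using c(2)[OF x] f kernel_integrable[OF N f x] by (intro integral_mono) (auto simp: space_restrict_space)
    finally show "norm (LINT t|leb l. N x t *v f t) \<le> c * (LINT t|leb l. norm (f t))" by simp
  qed (use c in auto)
qed

lemma kernel_integral_measurable:
  fixes N :: "real \<Rightarrow> real \<Rightarrow> complex^'q^'p"
  assumes N: "bounded_kernel l N" and f: "f \<in> borel_measurable (leb l)"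
  shows "(\<lambda>x. LINT t|leb l. N x t *v f t) \<in> borel_measurable (leb l)"
proof -
  interpret finite_measure "leb l" by (rule finite_measure_leb)
  have "(\<lambda>z. N (fst z) (snd z)) \<in> borel_measurable (leb l \<Otimes>\<^sub>M leb l)"
    by (rule bounded_kernel_measurable[OF N measurable_fst_leb measurable_snd_leb])
  moreover have "(\<lambda>z. f (snd z)) \<in> borel_measurable (leb l \<Otimes>\<^sub>M leb l)"
    using f by (rule measurable_compose[OF measurable_snd])
  ultimately have "(\<lambda>z. N (fst z) (snd z) *v f (snd z)) \<in> borel_measurable (leb l \<Otimes>\<^sub>M leb l)"
    by (rule measurable_matrix_vector_mult)
  then show ?thesis
    by (intro borel_measurable_lebesgue_integral) (simp only: split_beta')
qed

lemma kernel_integral_L2: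
  fixes N :: "real \<Rightarrow> real \<Rightarrow> complex^'q^'p"
  assumes N: "bounded_kernel l N" and f: "f \<in> L2 l"
  shows "(\<lambda>x. LINT t|leb l. N x t *v f t) \<in> L2 l"
proof -
  obtain c where "c \<ge> 0" "\<And>f x. integrable (leb l) f \<Longrightarrow> x \<in> {0<..<l} \<Longrightarrow>
    norm (LINT t|leb l. N x t *v f t) \<le> c * (LINT t|leb l. norm (f t))"
    using kernel_integral_bound[OF N] by blast
  with L2_bounded[OF kernel_integral_measurable[OF N L2_measurable[OF f]]] L2_integrable[OF f]
  show ?thesis by blast
qed

lemma kernel_op_L2:
  assumes "bounded_kernel l N" "f \<in> L2 l"
  shows "kernel_op l N f \<in> L2 l"
  using L2_add[OF assms(2) kernel_integral_L2[OF assms]] unfolding kernel_op_def[abs_def] .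

text \<open>The integral term is bounded pointwise by a multiple of the norm of $f$, by the Cauchy-Schwarz
  inequality, and the interval has finite length.\<close>

lemma L2_bounded_operator_kernel_op:
  fixes N :: "real \<Rightarrow> real \<Rightarrow> complex^'p^'p"
  assumes N: "bounded_kernel l N" and l: "0 < l"
  shows "L2_bounded_operator l (kernel_op l N)"
  unfolding L2_bounded_operator_def
proof (intro conjI ballI allI)
  fix f :: "real \<Rightarrow> complex^'p" assume "f \<in> L2 l" then show "kernel_op l N f \<in> L2 l" by (rule kernel_op_L2[OF N])
next
  fix f g :: "real \<Rightarrow> complex^'p" assume fg: "f \<in> L2 l" "g \<in> L2 l"
  show "ae_eq l (kernel_op l N (\<lambda>x. f x + g x)) (\<lambda>x. kernel_op l N f x + kernel_op l N g x)"
    unfolding ae_eq_def kernel_op_def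
    by (rule AE_leb_I) (simp add: matvec.add_right kernel_integrable[OF N L2_integrable] fg)
next
  fix c and f :: "real \<Rightarrow> complex^'p" assume f: "f \<in> L2 l"
  show "ae_eq l (kernel_op l N (\<lambda>x. c *s f x)) (\<lambda>x. c *s kernel_op l N f x)"
    unfolding ae_eq_def kernel_op_def
  proof (rule AE_leb_I)
    fix x assume x: "x \<in> {0<..<l}"
    have "N x t *v (c *s f t) = c *s (N x t *v f t)" for t
      by (simp add: vec_eq_iff matrix_vector_mult_def sum_distrib_left mult_ac)
    then show "c *s f x + (LINT t|leb l. N x t *v (c *s f t)) = c *s (f x + (LINT t|leb l. N x t *v f t))"
      by (simp add: integral_bounded_linear[OF bounded_linear_vector_smult kernel_integrable[OF N L2_integrable[OF f] x]]
          vector_add_ldistrib)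
  qed
next
  interpret finite_measure "leb l" by (rule finite_measure_leb)
  have m: "measure (leb l) (space (leb l)) = l"
    using l by (simp add: space_restrict_space measure_restrict_space)
  obtain c where c: "c \<ge> 0" "\<And>f x. integrable (leb l) f \<Longrightarrow> x \<in> {0<..<l} \<Longrightarrow>
    norm (LINT t|leb l. N x t *v f t) \<le> c * (LINT t|leb l. norm (f t))"
    using kernel_integral_bound[OF N] by blast
  show "\<exists>K. \<forall>f\<in>L2 l. L2norm l (kernel_op l N f) \<le> K * L2norm l f"
  proof (intro exI ballI)
    fix f :: "real \<Rightarrow> complex^'p" assume f: "f \<in> L2 l"
    define I where "I = (LINT x|leb l. (norm (f x))\<^sup>2)"
    have I0: "I \<ge> 0" by (simp add: I_def)
    define e where "e = c * sqrt l * L2norm l f"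
    have e2: "e\<^sup>2 = c\<^sup>2 * l * I" using l I0 by (simp add: e_def L2norm_def power_mult_distrib I_def)
    \<comment> \<open>from $(u + v)^2 \le 2u^2 + 2v^2$; this is the source of the constant
      $2 + 2c^2l^2$ below\<close>
    have pt: "(norm (kernel_op l N f x))\<^sup>2 \<le> 2 * (norm (f x))\<^sup>2 + 2 * e\<^sup>2" if "x \<in> {0<..<l}" for x
    proof -
      have "norm (LINT t|leb l. N x t *v f t) \<le> c * (LINT t|leb l. norm (f t))"
        using c(2)[OF L2_integrable[OF f] that] .
      also have "\<dots> \<le> e" unfolding e_def
        using integral_norm_le_L2norm[OF f l] c(1) by (simp add: mult.assoc mult_left_mono)
      finally have "norm (kernel_op l N f x) \<le> norm (f x) + e"
        unfolding kernel_op_def by (intro norm_triangle_le) simp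
      then have "(norm (kernel_op l N f x))\<^sup>2 \<le> (norm (f x) + e)\<^sup>2" by (intro power_mono) auto
      also have "\<dots> \<le> 2 * (norm (f x))\<^sup>2 + 2 * e\<^sup>2"
        using sum_squares_bound[of "norm (f x)" e] by (simp add: power2_sum)
      finally show ?thesis .
    qed
    have "(LINT x|leb l. (norm (kernel_op l N f x))\<^sup>2) \<le> (LINT x|leb l. 2 * (norm (f x))\<^sup>2 + 2 * e\<^sup>2)"
      using pt L2_square_integrable[OF f] L2_square_integrable[OF kernel_op_L2[OF N f]]
      by (intro integral_mono) (auto simp: space_restrict_space)
    also have "\<dots> = 2 * I + 2 * e\<^sup>2 * l"
      using L2_square_integrable[OF f] m by (simp add: I_def)
    also have "\<dots> = (2 + 2 * c\<^sup>2 * l\<^sup>2) * I" unfolding e2 by (simp add: algebra_simps power2_eq_square)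
    finally show "L2norm l (kernel_op l N f) \<le> sqrt (2 + 2 * c\<^sup>2 * l\<^sup>2) * L2norm l f"
      unfolding L2norm_def I_def[symmetric] by (simp add: real_sqrt_mult[symmetric])
  qed
qed

lemma kernel_prod_integrable:
  fixes N1 :: "real \<Rightarrow> real \<Rightarrow> complex^'q^'p" and N2 :: "real \<Rightarrow> real \<Rightarrow> complex^'r^'q"
  assumes N1: "bounded_kernel l N1" and N2: "bounded_kernel l N2"
    and x: "x \<in> {0<..<l}" and t: "t \<in> {0<..<l}"
  shows "integrable (leb l) (\<lambda>s. N1 x s ** N2 s t)"
proof -
  interpret finite_measure "leb l" by (rule finite_measure_leb)
  have m1: "N1 x \<in> borel_measurable (leb l)"
    by (rule bounded_kernel_measurable[OF N1 measurable_const measurable_id_leb]) simp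
  have m2: "(\<lambda>s. N2 s t) \<in> borel_measurable (leb l)"
    by (rule bounded_kernel_measurable[OF N2 measurable_id_leb measurable_const]) simp
  obtain b1 where b1: "\<And>x t. x \<in> {0<..<l} \<Longrightarrow> t \<in> {0<..<l} \<Longrightarrow> norm (N1 x t) \<le> b1"
    using N1 unfolding bounded_kernel_def by blast
  obtain b2 where b2: "\<And>x t. x \<in> {0<..<l} \<Longrightarrow> t \<in> {0<..<l} \<Longrightarrow> norm (N2 x t) \<le> b2"
    using N2 unfolding bounded_kernel_def by blast
  obtain K where K: "K \<ge> 0" "\<And>(X::complex^'q^'p) (Y::complex^'r^'q). norm (X ** Y) \<le> norm X * norm Y * K"
    using matmul.nonneg_bounded by blast
  show ?thesis
  proof (rule integrable_const_bound[where B = "\<bar>b1\<bar> * \<bar>b2\<bar> * K"])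
    show "AE s in leb l. norm (N1 x s ** N2 s t) \<le> \<bar>b1\<bar> * \<bar>b2\<bar> * K"
    proof (rule AE_leb_I)
      fix s assume s: "s \<in> {0<..<l}"
      have "norm (N1 x s ** N2 s t) \<le> norm (N1 x s) * norm (N2 s t) * K" by (rule K)
      also have "\<dots> \<le> \<bar>b1\<bar> * \<bar>b2\<bar> * K"
        using b1[OF x s] b2[OF s t] K(1) by (intro mult_right_mono mult_mono) auto
      finally show "norm (N1 x s ** N2 s t) \<le> \<bar>b1\<bar> * \<bar>b2\<bar> * K" .
    qed
  qed (rule measurable_matrix_matrix_mult[OF m1 m2])
qed

text \<open>The hypothesis says that the kernel of the product of the two integral operators is
  $-N_1-N_2$. By Fubini's theorem the three integral terms of $(I+N_1)(I+N_2)f$ then cancel,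
  leaving $f$.\<close>

lemma kernel_op_comp:
  fixes N1 N2 :: "real \<Rightarrow> real \<Rightarrow> complex^'p^'p"
  assumes N1: "bounded_kernel l N1" and N2: "bounded_kernel l N2"
    and comp: "\<And>x t. x \<in> {0<..<l} \<Longrightarrow> t \<in> {0<..<l} \<Longrightarrow>
        (LINT s|leb l. N1 x s ** N2 s t) = - N1 x t - N2 x t"
    and f: "f \<in> L2 l"
  shows "ae_eq l (kernel_op l N1 (kernel_op l N2 f)) f"
  unfolding ae_eq_def
proof (rule AE_leb_I)
  interpret finite_measure "leb l" by (rule finite_measure_leb)
  interpret pair_sigma_finite "leb l" "leb l" ..
  fix x assume x: "x \<in> {0<..<l}"
  have m1: "N1 x \<in> borel_measurable (leb l)"
    by (rule bounded_kernel_measurable[OF N1 measurable_const measurable_id_leb]) simp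
  have m2': "(\<lambda>z. N2 (fst z) (snd z)) \<in> borel_measurable (leb l \<Otimes>\<^sub>M leb l)"
    by (rule bounded_kernel_measurable[OF N2 measurable_fst_leb measurable_snd_leb])
  have m1': "(\<lambda>z. N1 x (fst z)) \<in> borel_measurable (leb l \<Otimes>\<^sub>M leb l)"
    using m1 by (rule measurable_compose[OF measurable_fst])
  have mf: "(\<lambda>z. f (snd z)) \<in> borel_measurable (leb l \<Otimes>\<^sub>M leb l)"
    using L2_measurable[OF f] by (rule measurable_compose[OF measurable_snd])
  note fi = L2_integrable[OF f]
  define g where "g = (\<lambda>s. LINT t|leb l. N2 s t *v f t)"
  have g: "g \<in> L2 l" unfolding g_def by (rule kernel_integral_L2[OF N2 f])
  obtain c1 where c1: "c1 \<ge> 0" "\<And>x t v. x \<in> {0<..<l} \<Longrightarrow> t \<in> {0<..<l} \<Longrightarrow> norm (N1 x t *v v) \<le> c1 * norm v"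
    using kernel_norm_bound[OF N1] by blast
  obtain c2 where c2: "c2 \<ge> 0" "\<And>x t v. x \<in> {0<..<l} \<Longrightarrow> t \<in> {0<..<l} \<Longrightarrow> norm (N2 x t *v v) \<le> c2 * norm v"
    using kernel_norm_bound[OF N2] by blast
  have "integrable (leb l \<Otimes>\<^sub>M leb l) (\<lambda>(s,t). norm (f t))"
    by (rule Fubini_integrable) (use fi mf in \<open>auto simp: split_beta'\<close>)
  then have "integrable (leb l \<Otimes>\<^sub>M leb l) (\<lambda>z. c1 * (c2 * norm (f (snd z))))"
    by (simp add: split_beta')
  then have Q: "integrable (leb l \<Otimes>\<^sub>M leb l) (\<lambda>(s, t). N1 x s *v (N2 s t *v f t))"
  proof (rule Bochner_Integration.integrable_bound[OF _ _ AE_I2])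
    fix z assume "z \<in> space (leb l \<Otimes>\<^sub>M leb l)"
    then obtain s t where z: "z = (s, t)" "s \<in> {0<..<l}" "t \<in> {0<..<l}"
      by (auto simp: space_pair_measure space_restrict_space)
    have "norm (N1 x s *v (N2 s t *v f t)) \<le> c1 * norm (N2 s t *v f t)" using c1 x z by blast
    also have "\<dots> \<le> c1 * (c2 * norm (f t))" using c1 c2 z by (intro mult_left_mono) auto
    finally show "norm (case z of (s, t) \<Rightarrow> N1 x s *v (N2 s t *v f t)) \<le> norm (c1 * (c2 * norm (f (snd z))))"
      using z c1 c2 by simp
  next
    show "(\<lambda>(s, t). N1 x s *v (N2 s t *v f t)) \<in> borel_measurable (leb l \<Otimes>\<^sub>M leb l)"
      unfolding split_beta' by (intro measurable_matrix_vector_mult m1' m2' mf)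
  qed
  note N1N2 = kernel_prod_integrable[OF N1 N2 x]
  have "(LINT s|leb l. N1 x s *v g s) = (LINT s|leb l. LINT t|leb l. N1 x s *v (N2 s t *v f t))"
  proof (rule Bochner_Integration.integral_cong[OF refl])
    fix s assume "s \<in> space (leb l)"
    then have s: "s \<in> {0<..<l}" by (simp add: space_restrict_space)
    show "N1 x s *v g s = (LINT t|leb l. N1 x s *v (N2 s t *v f t))"
      unfolding g_def
      by (rule integral_bounded_linear[OF matvec.bounded_linear_right kernel_integrable[OF N2 fi s], symmetric])
  qed
  also have "\<dots> = (LINT t|leb l. LINT s|leb l. N1 x s *v (N2 s t *v f t))"
    by (rule Fubini_integral[OF Q, symmetric])
  also have "\<dots> = (LINT t|leb l. - (N1 x t *v f t) - N2 x t *v f t)"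
  proof (rule Bochner_Integration.integral_cong[OF refl])
    fix t assume "t \<in> space (leb l)"
    then have t: "t \<in> {0<..<l}" by (simp add: space_restrict_space)
    have "(LINT s|leb l. N1 x s *v (N2 s t *v f t)) = (LINT s|leb l. (N1 x s ** N2 s t) *v f t)"
      by (simp add: matrix_vector_mul_assoc)
    also have "\<dots> = (LINT s|leb l. N1 x s ** N2 s t) *v f t"
      by (rule integral_bounded_linear[OF matvec.bounded_linear_left N1N2[OF t]])
    finally show "(LINT s|leb l. N1 x s *v (N2 s t *v f t)) = - (N1 x t *v f t) - N2 x t *v f t"
      by (simp add: comp[OF x t] matvec.diff_left matvec.minus_left)
  qed
  also have "\<dots> = - (LINT t|leb l. N1 x t *v f t) - g x"
    unfolding g_def using kernel_integrable[OF N1 fi x] kernel_integrable[OF N2 fi x] by simp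
  finally have eq: "(LINT s|leb l. N1 x s *v g s) = - (LINT t|leb l. N1 x t *v f t) - g x" .
  show "kernel_op l N1 (kernel_op l N2 f) x = f x"
    unfolding kernel_op_def g_def[symmetric] matvec.add_right
    using kernel_integrable[OF N1 fi x] kernel_integrable[OF N1 L2_integrable[OF g] x] eq
    by (simp add: g_def)
qed

lemma kernel_op_cong_ae:
  fixes N :: "real \<Rightarrow> real \<Rightarrow> complex^'p^'p"
  assumes N: "bounded_kernel l N" and "f \<in> L2 l" "g \<in> L2 l" "ae_eq l f g"
  shows "ae_eq l (kernel_op l N f) (kernel_op l N g)"
proof -
  have "(LINT t|leb l. N x t *v f t) = (LINT t|leb l. N x t *v g t)" if "x \<in> {0<..<l}" for x
    using assms(4) kernel_integrable[OF N L2_integrable that] assms(2,3)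
    unfolding ae_eq_def by (intro integral_cong_AE) (auto simp: borel_measurable_integrable)
  then show ?thesis using assms(4) unfolding ae_eq_def kernel_op_def
    by (auto intro: AE_leb_I elim!: AE_mp simp: space_restrict_space)
qed

lemma L2_bounded_operator_cong:
  assumes T: "L2_bounded_operator l T"
    and T': "\<And>f. f \<in> L2 l \<Longrightarrow> T' f \<in> L2 l" "\<And>f. f \<in> L2 l \<Longrightarrow> ae_eq l (T' f) (T f)"
  shows "L2_bounded_operator l T'"
  unfolding L2_bounded_operator_def
proof (intro conjI ballI allI)
  fix f g :: "real \<Rightarrow> complex^'a" assume f: "f \<in> L2 l" and g: "g \<in> L2 l"
  have "ae_eq l (T (\<lambda>x. f x + g x)) (\<lambda>x. T f x + T g x)"
    using T f g unfolding L2_bounded_operator_def by blast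
  moreover have "ae_eq l (\<lambda>x. T f x + T g x) (\<lambda>x. T' f x + T' g x)"
    using T'(2)[OF f] T'(2)[OF g] unfolding ae_eq_def by (rule AE_mp[OF _ AE_mp]) simp
  ultimately show "ae_eq l (T' (\<lambda>x. f x + g x)) (\<lambda>x. T' f x + T' g x)"
    using T'(2)[OF L2_add[OF f g]] ae_eq_trans by blast
next
  fix c and f :: "real \<Rightarrow> complex^'a" assume f: "f \<in> L2 l"
  have "ae_eq l (T (\<lambda>x. c *s f x)) (\<lambda>x. c *s T f x)"
    using T f unfolding L2_bounded_operator_def by blast
  moreover have "ae_eq l (\<lambda>x. c *s T f x) (\<lambda>x. c *s T' f x)"
    using T'(2)[OF f] unfolding ae_eq_def by (rule AE_mp) simp
  ultimately show "ae_eq l (T' (\<lambda>x. c *s f x)) (\<lambda>x. c *s T' f x)"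
    using T'(2)[OF L2_smult[OF f]] ae_eq_trans by blast
next
  obtain K where K: "\<And>f. f \<in> L2 l \<Longrightarrow> L2norm l (T f) \<le> K * L2norm l f"
    using T unfolding L2_bounded_operator_def by blast
  have "L2norm l (T' f) \<le> K * L2norm l f" if f: "f \<in> L2 l" for f
  proof -
    have "T f \<in> L2 l" using T f unfolding L2_bounded_operator_def by blast
    then show ?thesis using L2norm_cong[OF T'(1)[OF f] _ T'(2)[OF f]] K[OF f] by simp
  qed
  then show "\<exists>K. \<forall>f\<in>L2 l. L2norm l (T' f) \<le> K * L2norm l f" by blast
qed (rule T'(1))

text \<open>The inverse to which this is applied arises from a choice of representatives, so
  \<open>R\<close> is compared with an integral operator only up to null sets.\<close>

lemma L2_inverse_kernel_op:
  fixes N1 N2 :: "real \<Rightarrow> real \<Rightarrow> complex^'p^'p"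
  assumes l: "0 < l" and N1: "bounded_kernel l N1" and N2: "bounded_kernel l N2"
    and c12: "\<And>x t. x \<in> {0<..<l} \<Longrightarrow> t \<in> {0<..<l} \<Longrightarrow> (LINT s|leb l. N1 x s ** N2 s t) = - N1 x t - N2 x t"
    and c21: "\<And>x t. x \<in> {0<..<l} \<Longrightarrow> t \<in> {0<..<l} \<Longrightarrow> (LINT s|leb l. N2 x s ** N1 s t) = - N2 x t - N1 x t"
    and S: "\<And>f x. f \<in> L2 l \<Longrightarrow> x \<in> {0<..<l} \<Longrightarrow> S f x = kernel_op l N1 f x"
    and R: "\<And>f. f \<in> L2 l \<Longrightarrow> R f \<in> L2 l" "\<And>f. f \<in> L2 l \<Longrightarrow> ae_eq l (R f) (kernel_op l N2 f)"
  shows "L2_inverse l S R"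
proof -
  have S': "S f \<in> L2 l" "ae_eq l (S f) (kernel_op l N1 f)" if "f \<in> L2 l" for f
    using L2_cong[OF S kernel_op_L2[OF N1]] S that unfolding ae_eq_def by (auto intro: AE_leb_I)
  show ?thesis unfolding L2_inverse_def
  proof (intro conjI ballI)
    show "L2_bounded_operator l S"
      by (rule L2_bounded_operator_cong[OF L2_bounded_operator_kernel_op[OF N1 l] S'])
    show "L2_bounded_operator l R"
      by (rule L2_bounded_operator_cong[OF L2_bounded_operator_kernel_op[OF N2 l] R])
  next
    fix f :: "real \<Rightarrow> complex^'p" assume f: "f \<in> L2 l"
    show "ae_eq l (S (R f)) f"
      using S'(2)[OF R(1)[OF f]] kernel_op_cong_ae[OF N1 R(1)[OF f] kernel_op_L2[OF N2 f] R(2)[OF f]]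
        kernel_op_comp[OF N1 N2 c12 f] ae_eq_trans by blast
    show "ae_eq l (R (S f)) f"
      using R(2)[OF S'(1)[OF f]] kernel_op_cong_ae[OF N2 S'(1)[OF f] kernel_op_L2[OF N1 f] S'(2)[OF f]]
        kernel_op_comp[OF N2 N1 c21 f] ae_eq_trans by blast
  qed
qed

lemma norm_entry_le: "norm ((A::complex^'q^'p) $ i $ j) \<le> norm A"
  by (rule order_trans[OF Finite_Cartesian_Product.norm_nth_le Finite_Cartesian_Product.norm_nth_le])

lemma kernel_entry_integrable:
  fixes N :: "real \<Rightarrow> real \<Rightarrow> complex^'q^'p"
  assumes N: "bounded_kernel a N" and y: "y \<in> {0<..<a}" and g: "integrable (leb a) g"
  shows "integrable (leb a) (\<lambda>s. N y s $ i $ j * g s)"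
proof -
  obtain c where c: "\<And>x t. x \<in> {0<..<a} \<Longrightarrow> t \<in> {0<..<a} \<Longrightarrow> norm (N x t) \<le> c"
    using N unfolding bounded_kernel_def by blast
  have "N y \<in> borel_measurable (leb a)"
    by (rule bounded_kernel_measurable[OF N measurable_const measurable_id_leb]) simp
  from measurable_vec_nth[OF measurable_vec_nth[OF this]]
  have m: "(\<lambda>s. N y s $ i $ j) \<in> borel_measurable (leb a)" .
  have "integrable (leb a) (\<lambda>s. \<bar>c\<bar> * norm (g s))" using g by simp
  then show ?thesis
  proof (rule Bochner_Integration.integrable_bound[OF _ _ AE_I2])
    show "(\<lambda>s. N y s $ i $ j * g s) \<in> borel_measurable (leb a)"
      using m g by (intro borel_measurable_times) auto
    fix s assume "s \<in> space (leb a)"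
    then have "norm (N y s) \<le> c" by (intro c y) (simp add: space_restrict_space)
    moreover have "norm (N y s $ i $ j) \<le> norm (N y s)" by (rule norm_entry_le)
    ultimately have "norm (N y s $ i $ j) \<le> \<bar>c\<bar>" by linarith
    then show "norm (N y s $ i $ j * g s) \<le> norm (\<bar>c\<bar> * norm (g s))"
      by (simp add: norm_mult mult_right_mono)
  qed
qed

lemma kernel_column_entry_integrable:
  fixes N :: "real \<Rightarrow> real \<Rightarrow> complex^'q^'p"
  assumes N: "bounded_kernel a N" and z: "z \<in> {0<..<a}"
  shows "integrable (leb a) (\<lambda>s. N s z $ i $ j)"
proof -
  interpret finite_measure "leb a" by (rule finite_measure_leb)
  obtain c where c: "\<And>x t. x \<in> {0<..<a} \<Longrightarrow> t \<in> {0<..<a} \<Longrightarrow> norm (N x t) \<le> c"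
    using N unfolding bounded_kernel_def by blast
  have "(\<lambda>s. N s z) \<in> borel_measurable (leb a)"
    by (rule bounded_kernel_measurable[OF N measurable_id_leb measurable_const]) simp
  moreover have "AE s in leb a. norm (N s z) \<le> c" using c z by (intro AE_leb_I) auto
  ultimately have "integrable (leb a) (\<lambda>s. N s z)" by (intro integrable_const_bound)
  then show ?thesis by (intro integrable_bounded_linear[OF bounded_linear_vec_nth])
qed

section \<open>Composition of semi-separable kernels\<close>

text \<open>The sign convention is that of input-output systems with boundary conditions: if $Q + P = I$,
  the kernel jumps by $F(y)G(y)$ across the diagonal.\<close>

definition semisep :: "(real \<Rightarrow> complex^'m^'p) \<Rightarrow> complex^'m^'m \<Rightarrow> complex^'m^'m \<Rightarrow> (real \<Rightarrow> complex^'q^'m)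
    \<Rightarrow> real \<Rightarrow> real \<Rightarrow> complex^'q^'p" where
  "semisep F Q P G y z = (if z < y then F y ** Q ** G z else - (F y ** P ** G z))"

definition bounded_borel :: "real \<Rightarrow> (real \<Rightarrow> complex^'q^'p) \<Rightarrow> bool" where
  "bounded_borel a F \<longleftrightarrow> F \<in> borel_measurable borel \<and> bounded (F ` {0..a})"

lemma bounded_borel_continuous: "continuous_on UNIV F \<Longrightarrow> bounded_borel a F"
  unfolding bounded_borel_def
  using compact_imp_bounded[OF compact_continuous_image[of "{0..a}" F]] continuous_on_subset[of UNIV F "{0..a}"]
  by (auto intro: borel_measurable_continuous_onI)

lemma bounded_borel_mult:
  fixes F :: "real \<Rightarrow> complex^'q^'p" and G :: "real \<Rightarrow> complex^'r^'q"
  assumes "bounded_borel a F" "bounded_borel a G" shows "bounded_borel a (\<lambda>y. F y ** G y)"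
proof -
  obtain b1 where b1: "\<And>y. y \<in> {0..a} \<Longrightarrow> norm (F y) \<le> b1"
    using assms(1) unfolding bounded_borel_def bounded_iff by blast
  obtain b2 where b2: "\<And>y. y \<in> {0..a} \<Longrightarrow> norm (G y) \<le> b2"
    using assms(2) unfolding bounded_borel_def bounded_iff by blast
  obtain K where K: "K \<ge> 0" "\<And>(X::complex^'q^'p) (Y::complex^'r^'q). norm (X ** Y) \<le> norm X * norm Y * K"
    using matmul.nonneg_bounded by blast
  have "norm (F y ** G y) \<le> \<bar>b1\<bar> * \<bar>b2\<bar> * K" if "y \<in> {0..a}" for y
  proof -
    have "norm (F y ** G y) \<le> norm (F y) * norm (G y) * K" by (rule K)
    also have "\<dots> \<le> \<bar>b1\<bar> * \<bar>b2\<bar> * K"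
      using b1[OF that] b2[OF that] K(1) by (intro mult_right_mono mult_mono) auto
    finally show ?thesis .
  qed
  then have "bounded ((\<lambda>y. F y ** G y) ` {0..a})" unfolding bounded_iff by blast
  with assms show ?thesis unfolding bounded_borel_def
    by (blast intro: measurable_matrix_matrix_mult)
qed

lemma bounded_borel_const: "bounded_borel a (\<lambda>_. A)" by (rule bounded_borel_continuous) simp

lemma bounded_kernel_semisep:
  fixes F :: "real \<Rightarrow> complex^'b^'a" and G :: "real \<Rightarrow> complex^'c^'b"
  assumes "bounded_borel a F" "bounded_borel a G"
  shows "bounded_kernel a (semisep F Q P G)"
  unfolding bounded_kernel_def
proof
  have F: "(\<lambda>z. F (fst z)) \<in> borel_measurable borel"
    using assms(1) by (intro measurable_compose[of fst borel borel F])
      (auto simp: bounded_borel_def intro!: borel_measurable_continuous_onI continuous_intros)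
  have G: "(\<lambda>z. G (snd z)) \<in> borel_measurable borel"
    using assms(2) by (intro measurable_compose[of snd borel borel G])
      (auto simp: bounded_borel_def intro!: borel_measurable_continuous_onI continuous_intros)
  have S: "{z \<in> space borel. snd z < fst z} \<in> sets (borel :: (real\<times>real) measure)"
    by (auto intro!: borel_open open_Collect_less continuous_intros)
  show "(\<lambda>z. semisep F Q P G (fst z) (snd z)) \<in> borel_measurable borel"
    unfolding semisep_def
    by (intro measurable_If[OF _ _ S] measurable_matrix_matrix_mult F G borel_measurable_uminus measurable_const) simp_all
next
  obtain b1 where b1: "\<And>y. y \<in> {0..a} \<Longrightarrow> norm (F y ** Q) \<le> b1"
    using bounded_borel_mult[OF assms(1) bounded_borel_const, of Q] unfolding bounded_borel_def bounded_iff by blast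
  obtain b2 where b2: "\<And>y. y \<in> {0..a} \<Longrightarrow> norm (F y ** P) \<le> b2"
    using bounded_borel_mult[OF assms(1) bounded_borel_const, of P] unfolding bounded_borel_def bounded_iff by blast
  obtain b3 where b3: "\<And>y. y \<in> {0..a} \<Longrightarrow> norm (G y) \<le> b3"
    using assms(2) unfolding bounded_borel_def bounded_iff by blast
  note b = b1 b2 b3
  obtain K where K: "K \<ge> 0" "\<And>(X::complex^'b^'a) (Y::complex^'c^'b). norm (X ** Y) \<le> norm X * norm Y * K"
    using matmul.nonneg_bounded by blast
  show "\<exists>c. \<forall>y\<in>{0<..<a}. \<forall>z\<in>{0<..<a}. norm (semisep F Q P G y z) \<le> c"
  proof (intro exI ballI)
    fix y z assume yz: "y \<in> {0<..<a}" "z \<in> {0<..<a}"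
    have *: "norm (X ** G z) \<le> (\<bar>b1\<bar> + \<bar>b2\<bar>) * \<bar>b3\<bar> * K" if "norm X \<le> \<bar>b1\<bar> + \<bar>b2\<bar>" for X :: "complex^'b^'a"
    proof -
      have "norm (X ** G z) \<le> norm X * norm (G z) * K" by (rule K)
      also have "\<dots> \<le> (\<bar>b1\<bar> + \<bar>b2\<bar>) * \<bar>b3\<bar> * K"
        using that b(3)[of z] yz K(1) by (intro mult_right_mono mult_mono) auto
      finally show ?thesis .
    qed
    have "norm (F y ** Q) \<le> \<bar>b1\<bar> + \<bar>b2\<bar>" "norm (F y ** P) \<le> \<bar>b1\<bar> + \<bar>b2\<bar>" using b(1)[of y] b(2)[of y] yz by auto
    then show "norm (semisep F Q P G y z) \<le> (\<bar>b1\<bar> + \<bar>b2\<bar>) * \<bar>b3\<bar> * K"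
      unfolding semisep_def using * by (auto)
  qed
qed

lemma has_integral_sandwich:
  fixes M :: "real \<Rightarrow> complex^'r^'m" and X :: "complex^'m^'p" and Y :: "complex^'s^'r"
  assumes "finite Z" "continuous_on {u..v} M" "u \<le> v"
    and "\<And>t. t \<in> {u<..<v} - Z \<Longrightarrow> (M has_vector_derivative M' t) (at t)"
    and "\<And>t. t \<in> {u<..<v} \<Longrightarrow> \<phi> t = X ** M' t ** Y"
  shows "(\<phi> has_integral X ** M v ** Y - X ** M u ** Y) {u..v}"
proof -
  have L: "bounded_linear (\<lambda>N. X ** N ** Y)"
    by (intro bounded_linear_compose[OF matmul.bounded_linear_left matmul.bounded_linear_right])
  have "((\<lambda>t. X ** M' t ** Y) has_integral X ** M v ** Y - X ** M u ** Y) {u..v}"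
    using assms(1,3)
    by (rule fundamental_theorem_of_calculus_interior_strong)
       (use assms bounded_linear.has_vector_derivative[OF L] bounded_linear.continuous_on[OF L] in auto)
  then have "((\<lambda>t. X ** M' t ** Y) has_integral X ** M v ** Y - X ** M u ** Y) {u<..<v}"
    by (simp add: has_integral_Icc_iff_Ioo)
  then have "(\<phi> has_integral X ** M v ** Y - X ** M u ** Y) {u<..<v}"
    by (rule has_integral_eq[rotated]) (use assms(5) in auto)
  then show ?thesis by (simp add: has_integral_Icc_iff_Ioo)
qed

text \<open>On each of the three intervals into which $y$ and $z$ divide $(0,a)$, the integrand is a
  constant matrix times $G_1F_2 = M'$ times a constant matrix. Adding up the increments of $M$,
  the terms with $M(0)$ and $M(a)$ cancel by the boundary condition \<open>bc\<close>, and the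
  terms at $y$ and $z$ combine by $P_i + Q_i = I$.\<close>

lemma semisep_comp:
  fixes F1 :: "real \<Rightarrow> complex^'m^'p" and G1 :: "real \<Rightarrow> complex^'q^'m"
    and F2 :: "real \<Rightarrow> complex^'r^'q" and G2 :: "real \<Rightarrow> complex^'s^'r"
    and M :: "real \<Rightarrow> complex^'r^'m"
  assumes bd: "bounded_borel a F1" "bounded_borel a G1" "bounded_borel a F2" "bounded_borel a G2"
    and Z: "finite Z" and cont: "continuous_on {0..a} M"
    and deriv: "\<And>t. t \<in> {0<..<a} - Z \<Longrightarrow> (M has_vector_derivative G1 t ** F2 t) (at t)"
    and PQ: "P1 + Q1 = mat 1" "P2 + Q2 = mat 1"
    and bc: "Q1 ** M 0 ** P2 = P1 ** M a ** Q2"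
    and y: "y \<in> {0<..<a}" and z: "z \<in> {0<..<a}"
  shows "(LINT t|leb a. semisep F1 Q1 P1 G1 y t ** semisep F2 Q2 P2 G2 t z) =
    (if z < y then F1 y ** (M y ** Q2 - Q1 ** M z) ** G2 z
     else F1 y ** (P1 ** M z - M y ** P2) ** G2 z)"
proof -
  let ?\<phi> = "\<lambda>t. semisep F1 Q1 P1 G1 y t ** semisep F2 Q2 P2 G2 t z"
  note D = matmul.add_left matmul.add_right matmul.diff_left matmul.diff_right matmul.minus_left matmul.minus_right matrix_mul_assoc
  have I: "(?\<phi> has_integral (F1 y ** X) ** M v ** (Y ** G2 z) - (F1 y ** X) ** M u ** (Y ** G2 z)) {u..v}"
    if "0 \<le> u" "u \<le> v" "v \<le> a" "\<And>t. t \<in> {u<..<v} \<Longrightarrow> semisep F1 Q1 P1 G1 y t = F1 y ** X ** G1 t"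
     "\<And>t. t \<in> {u<..<v} \<Longrightarrow> semisep F2 Q2 P2 G2 t z = F2 t ** Y ** G2 z" for u v X Y
  proof (rule has_integral_sandwich[OF Z _ \<open>u \<le> v\<close>])
    show "continuous_on {u..v} M" by (rule continuous_on_subset[OF cont]) (use that in auto)
    show "(M has_vector_derivative G1 t ** F2 t) (at t)" if "t \<in> {u<..<v} - Z" for t
      using that \<open>0 \<le> u\<close> \<open>v \<le> a\<close> by (intro deriv) auto
  qed (simp add: that matrix_mul_assoc)
  have main: "(?\<phi> has_integral (if z < y then F1 y ** (M y ** Q2 - Q1 ** M z) ** G2 z
     else F1 y ** (P1 ** M z - M y ** P2) ** G2 z)) {0..a}"
  proof (cases "z < y")
    case True
    have 1: "(?\<phi> has_integral (F1 y ** Q1) ** M z ** (- P2 ** G2 z) - (F1 y ** Q1) ** M 0 ** (- P2 ** G2 z)) {0..z}"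
      by (rule I) (use y z True in \<open>auto simp: semisep_def D\<close>)
    have 2: "(?\<phi> has_integral (F1 y ** Q1) ** M y ** (Q2 ** G2 z) - (F1 y ** Q1) ** M z ** (Q2 ** G2 z)) {z..y}"
      by (rule I) (use y z True in \<open>auto simp: semisep_def D\<close>)
    have 3: "(?\<phi> has_integral (F1 y ** - P1) ** M a ** (Q2 ** G2 z) - (F1 y ** - P1) ** M y ** (Q2 ** G2 z)) {y..a}"
      by (rule I) (use y z True in \<open>auto simp: semisep_def D\<close>)
    have eq: "((F1 y ** Q1) ** M z ** (- P2 ** G2 z) - (F1 y ** Q1) ** M 0 ** (- P2 ** G2 z)) +
       ((F1 y ** Q1) ** M y ** (Q2 ** G2 z) - (F1 y ** Q1) ** M z ** (Q2 ** G2 z)) +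
       ((F1 y ** - P1) ** M a ** (Q2 ** G2 z) - (F1 y ** - P1) ** M y ** (Q2 ** G2 z))
      = F1 y ** (M y ** Q2 - Q1 ** M z) ** G2 z" (is "?L = ?R")
    proof -
      have "?L = F1 y ** (- (Q1 ** M z ** (P2 + Q2)) + Q1 ** M 0 ** P2 + (Q1 + P1) ** M y ** Q2 - P1 ** M a ** Q2) ** G2 z"
        by (simp add: D)
      also have "\<dots> = ?R" using PQ bc by (simp add: add.commute)
      finally show ?thesis .
    qed
    from has_integral_combine[OF _ _ has_integral_combine[OF _ _ 1 2] 3] y z True eq show ?thesis by simp
  next
    case False
    have 1: "(?\<phi> has_integral (F1 y ** Q1) ** M y ** (- P2 ** G2 z) - (F1 y ** Q1) ** M 0 ** (- P2 ** G2 z)) {0..y}"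
      by (rule I) (use y z False in \<open>auto simp: semisep_def D\<close>)
    have 2: "(?\<phi> has_integral (F1 y ** - P1) ** M z ** (- P2 ** G2 z) - (F1 y ** - P1) ** M y ** (- P2 ** G2 z)) {y..z}"
      by (rule I) (use y z False in \<open>auto simp: semisep_def D\<close>)
    have 3: "(?\<phi> has_integral (F1 y ** - P1) ** M a ** (Q2 ** G2 z) - (F1 y ** - P1) ** M z ** (Q2 ** G2 z)) {z..a}"
      by (rule I) (use y z False in \<open>auto simp: semisep_def D\<close>)
    have eq: "((F1 y ** Q1) ** M y ** (- P2 ** G2 z) - (F1 y ** Q1) ** M 0 ** (- P2 ** G2 z)) +
       ((F1 y ** - P1) ** M z ** (- P2 ** G2 z) - (F1 y ** - P1) ** M y ** (- P2 ** G2 z)) +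
       ((F1 y ** - P1) ** M a ** (Q2 ** G2 z) - (F1 y ** - P1) ** M z ** (Q2 ** G2 z))
      = F1 y ** (P1 ** M z - M y ** P2) ** G2 z" (is "?L = ?R")
    proof -
      have "?L = F1 y ** (P1 ** M z ** (P2 + Q2) + Q1 ** M 0 ** P2 - (Q1 + P1) ** M y ** P2 - P1 ** M a ** Q2) ** G2 z"
        by (simp add: D)
      also have "\<dots> = ?R" using PQ bc by (simp add: add.commute)
      finally show ?thesis .
    qed
    from has_integral_combine[OF _ _ has_integral_combine[OF _ _ 1 2] 3] y z False eq show ?thesis by simp
  qed
  have "integrable (leb a) ?\<phi>"
    by (intro kernel_prod_integrable bounded_kernel_semisep bd y z)
  from lebesgue_integral_eq_integral[OF this] main show ?thesis
    by (simp add: has_integral_Icc_iff_Ioo integral_unique)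
qed

section \<open>Dilations and the operator E\<close>

lemma dilate_Ioo:
  assumes "0 < d" "d * l \<le> a" "x \<in> {0<..<l::real}" shows "d * x \<in> {0<..<a}"
proof -
  have "d * x < d * l" using assms by simp
  then have "d * x < a" using assms(2) by linarith
  with assms show ?thesis by simp
qed

text \<open>Extended by zero, both integrals are taken over the whole line; the support condition removes
  the part of $(0,a)$ beyond $c l$.\<close>

lemma
  fixes g :: "real \<Rightarrow> 'a::euclidean_space"
  assumes c: "0 < c" "c * l \<le> a" and g: "\<And>z. c * l \<le> z \<Longrightarrow> g z = 0"
  shows integrable_scale_leb: "integrable (leb a) g \<longleftrightarrow> integrable (leb l) (\<lambda>s. g (c * s))" (is ?th1)
    and integral_scale_leb: "(LINT z|leb a. g z) = c *\<^sub>R (LINT s|leb l. g (c * s))" (is ?th2)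
proof -
  define h where "h = (\<lambda>z. indicat_real {0<..<a} z *\<^sub>R g z)"
  have h: "h (0 + c * s) = indicat_real {0<..<l} s *\<^sub>R g (c * s)" for s
  proof (cases "s < l")
    case True
    then have "c * s < a" using c by (meson less_le_trans mult_strict_left_mono)
    with True c show ?thesis by (auto simp: h_def indicator_def zero_less_mult_iff)
  next
    case False
    then show ?thesis using c g[of "c * s"] by (auto simp: h_def)
  qed
  show ?th1
    using lebesgue_integrable_real_affine_iff[of c h 0] c unfolding h
    by (simp add: integrable_restrict_space h_def)
  show ?th2
    using lebesgue_integral_real_affine[of c h 0] c unfolding h
    by (simp add: integral_restrict_space h_def)
qed

text \<open>The kernel on $(0,l)$ that results from the substitutions $y = d_i x$ and $z = d_j t$; the
  factor \<open>d j\<close> is the Jacobian of the latter.\<close>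

definition dilate_kernel :: "('p \<Rightarrow> real) \<Rightarrow> (real \<Rightarrow> real \<Rightarrow> complex^'p^'p) \<Rightarrow> real \<Rightarrow> real \<Rightarrow> complex^'p^'p" where
  "dilate_kernel d N x t = (\<chi> i j. N (d i * x) (d j * t) $ i $ j * of_real (d j))"

lemma bounded_kernel_dilate:
  fixes d :: "'p::finite \<Rightarrow> real"
  assumes N: "bounded_kernel a N" and d: "\<And>i. 0 < d i" "\<And>i. d i * l \<le> a"
  shows "bounded_kernel l (dilate_kernel d N)"
  unfolding bounded_kernel_def
proof
  show "(\<lambda>z. dilate_kernel d N (fst z) (snd z)) \<in> borel_measurable borel"
  proof (intro measurable_vec)
    fix i j
    have "(\<lambda>z. N (d i * fst z) (d j * snd z)) \<in> borel_measurable borel"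
      by (intro bounded_kernel_measurable[OF N] borel_measurable_continuous_onI continuous_intros)
    from measurable_vec_nth[OF measurable_vec_nth[OF this]]
    show "(\<lambda>z. dilate_kernel d N (fst z) (snd z) $ i $ j) \<in> borel_measurable borel"
      unfolding dilate_kernel_def by simp
  qed
next
  obtain c where c: "\<And>x t. x \<in> {0<..<a} \<Longrightarrow> t \<in> {0<..<a} \<Longrightarrow> norm (N x t) \<le> c"
    using N unfolding bounded_kernel_def by blast
  have dl: "d i * x \<in> {0<..<a}" if "x \<in> {0<..<l}" for i x
    by (rule dilate_Ioo[OF d that])
  show "\<exists>c. \<forall>x\<in>{0<..<l}. \<forall>t\<in>{0<..<l}. norm (dilate_kernel d N x t) \<le> c"
  proof (intro exI ballI)
    fix x t assume xt: "x \<in> {0<..<l}" "t \<in> {0<..<l}"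
    have "norm (dilate_kernel d N x t) \<le> (\<Sum>i\<in>UNIV. norm (dilate_kernel d N x t $ i))" by (simp add: norm_vec_def L2_set_le_sum)
    also have "\<dots> \<le> (\<Sum>i\<in>UNIV. \<Sum>j\<in>UNIV. norm (dilate_kernel d N x t $ i $ j))"
      by (intro sum_mono) (simp add: norm_vec_def L2_set_le_sum)
    also have "\<dots> \<le> (\<Sum>i\<in>(UNIV::'p set). \<Sum>j\<in>UNIV. c * d j)"
    proof (intro sum_mono)
      fix i j
      have "norm (N (d i * x) (d j * t) $ i $ j) \<le> norm (N (d i * x) (d j * t))"
        by (rule norm_entry_le)
      also have "\<dots> \<le> c" by (intro c dl xt)
      finally show "norm (dilate_kernel d N x t $ i $ j) \<le> c * d j"
        using d(1)[of j] by (simp add: dilate_kernel_def norm_mult mult_right_mono)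
    qed
    finally show "norm (dilate_kernel d N x t) \<le> (\<Sum>i\<in>(UNIV::'p set). \<Sum>j\<in>UNIV. c * d j)" .
  qed
qed

text \<open>In the \<open>m\<close>-th term of the matrix product, substitute $\sigma = d_m s$. The
  support condition on \<open>N2\<close> lets the resulting integral over $(0, d_m l)$ be
  extended to $(0,a)$, which makes the interval independent of \<open>m\<close>.\<close>

lemma dilate_kernel_comp:
  fixes d :: "'p::finite \<Rightarrow> real"
  assumes N1: "bounded_kernel a N1" and N2: "bounded_kernel a N2"
    and d: "\<And>i. 0 < d i" "\<And>i. d i * l \<le> a"
    and supp: "\<And>i j y z. d i * l \<le> y \<Longrightarrow> N2 y z $ i $ j = 0"
    and x: "x \<in> {0<..<l}" and t: "t \<in> {0<..<l}"
  shows "(LINT s|leb l. dilate_kernel d N1 x s ** dilate_kernel d N2 s t) = dilate_kernel d (\<lambda>y z. LINT s|leb a. N1 y s ** N2 s z) x t"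
proof -
  have dl: "d i * x \<in> {0<..<a}" if "x \<in> {0<..<l}" for i x
    by (rule dilate_Ioo[OF d that])
  have entry: "(LINT s|M. f s) $ i $ j = (LINT s|M. f s $ i $ j)" if "integrable M f"
    for M :: "real measure" and f :: "real \<Rightarrow> complex^'p^'p" and i j
    using integral_bounded_linear[OF bounded_linear_vec_nth that]
      integral_bounded_linear[OF bounded_linear_vec_nth integrable_bounded_linear[OF bounded_linear_vec_nth that]]
    by simp
  have "(LINT s|leb l. dilate_kernel d N1 x s ** dilate_kernel d N2 s t) $ i $ j
      = dilate_kernel d (\<lambda>y z. LINT s|leb a. N1 y s ** N2 s z) x t $ i $ j" for i j
  proof -
    define g where "g m \<sigma> = N1 (d i * x) \<sigma> $ i $ m * N2 \<sigma> (d j * t) $ m $ j" for m \<sigma>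
    have I1: "integrable (leb l) (\<lambda>s. dilate_kernel d N1 x s ** dilate_kernel d N2 s t)"
      by (intro kernel_prod_integrable bounded_kernel_dilate[OF N1] bounded_kernel_dilate[OF N2] d x t)
    have I2: "integrable (leb a) (\<lambda>s. N1 (d i * x) s ** N2 s (d j * t))"
      by (intro kernel_prod_integrable N1 N2 dl x t)
    have gi: "integrable (leb a) (g m)" for m
      unfolding g_def by (intro kernel_entry_integrable kernel_column_entry_integrable N1 N2 dl x t)
    have gs: "g m z = 0" if "d m * l \<le> z" for m z using supp[OF that] by (simp add: g_def)
    have gi': "integrable (leb l) (\<lambda>s. g m (d m * s))" for m
      using gi integrable_scale_leb[OF d, of m "g m"] gs by blast
    have "(LINT s|leb l. dilate_kernel d N1 x s ** dilate_kernel d N2 s t) $ i $ j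
        = (LINT s|leb l. (\<Sum>m\<in>UNIV. of_real (d m) * g m (d m * s)) * of_real (d j))"
      unfolding entry[OF I1]
      by (intro Bochner_Integration.integral_cong refl)
        (simp add: dilate_kernel_def g_def matrix_matrix_mult_def sum_distrib_right sum_distrib_left mult_ac)
    also have "\<dots> = (\<Sum>m\<in>UNIV. of_real (d m) * (LINT s|leb l. g m (d m * s))) * of_real (d j)"
      using gi' by simp
    also have "\<dots> = (\<Sum>m\<in>UNIV. (LINT s|leb a. g m s)) * of_real (d j)"
      using integral_scale_leb[OF d gs] by (simp add: scaleR_conv_of_real)
    also have "\<dots> = (LINT s|leb a. (\<Sum>m\<in>UNIV. g m s)) * of_real (d j)"
      using gi by simp
    also have "\<dots> = dilate_kernel d (\<lambda>y z. LINT s|leb a. N1 y s ** N2 s z) x t $ i $ j"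
      unfolding dilate_kernel_def by (simp add: entry[OF I2]) (simp add: g_def matrix_matrix_mult_def)
    finally show ?thesis .
  qed
  then show ?thesis by (simp add: vec_eq_iff)
qed

text \<open>The components of $Ef$ vanish beyond $d_j l$, so the integral over $(0,a)$ becomes one over
  $(0,l)$ in each component. For $y \ge d_i l$ both sides vanish in the \<open>i\<close>-th
  component by the support condition.\<close>

lemma E_kernel_op:
  fixes d :: "'p::finite \<Rightarrow> real"
  assumes N: "bounded_kernel a N"
    and d: "\<And>i. 0 < d i" "\<And>i. d i * l \<le> a"
    and supp: "\<And>i j y z. d i * l \<le> y \<Longrightarrow> N y z $ i $ j = 0"
    and f: "f \<in> L2 l" and y: "y \<in> {0<..<a}"
  shows "kernel_op a N (E_op l d f) y = E_op l d (kernel_op l (dilate_kernel d N) f) y"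
proof -
  have Ej: "E_op l d f z $ j = 0" if "d j * l \<le> z" for j z using that by (simp add: E_op_def)
  have Es: "E_op l d f (d j * s) $ j = f s $ j" if "s \<in> {0<..<l}" for j s
    using that d(1)[of j] by (simp add: E_op_def)
  have fj: "integrable (leb l) (\<lambda>s. f s $ j)" for j
    by (intro integrable_bounded_linear[OF bounded_linear_vec_nth] L2_integrable f)
  have Eij: "integrable (leb a) (\<lambda>z. E_op l d f z $ j)" for j
  proof -
    have "integrable (leb l) (\<lambda>s. E_op l d f (d j * s) $ j)"
      using fj[of j] by (rule Bochner_Integration.integrable_cong[THEN iffD2, rotated 2])
         (auto simp: Es space_restrict_space)
    then show ?thesis using integrable_scale_leb[OF d, of j "\<lambda>z. E_op l d f z $ j"] Ej by blast
  qed
  have "E_op l d f z = (\<Sum>j\<in>UNIV. E_op l d f z $ j *s axis j 1)" for z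
    by (simp add: vec_eq_iff axis_def if_distrib sum.delta cong: if_cong)
  moreover have "integrable (leb a) (\<lambda>z. \<Sum>j\<in>UNIV. E_op l d f z $ j *s axis j 1)"
  proof (intro Bochner_Integration.integrable_sum)
    fix j
    have "bounded_linear (\<lambda>c::complex. c *s (axis j 1 :: complex^'p))"
      unfolding linear_conv_bounded_linear[symmetric]
      by (auto intro!: linearI simp: vec_eq_iff algebra_simps)
    from integrable_bounded_linear[OF this Eij[of j]]
    show "integrable (leb a) (\<lambda>z. E_op l d f z $ j *s (axis j 1 :: complex^'p))" .
  qed
  ultimately have Ei: "integrable (leb a) (E_op l d f)" by (metis (no_types, lifting) Bochner_Integration.integrable_cong)
  show "kernel_op a N (E_op l d f) y = E_op l d (kernel_op l (dilate_kernel d N) f) y"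
  proof (rule vec_eq_iff[THEN iffD2], rule allI)
    fix i
    have prod: "integrable (leb a) (\<lambda>z. N y z $ i $ j * E_op l d f z $ j)" for j
      by (intro kernel_entry_integrable N y Eij)
    have "(LINT z|leb a. N y z *v E_op l d f z) $ i = (LINT z|leb a. (\<Sum>j\<in>UNIV. N y z $ i $ j * E_op l d f z $ j))"
      using integral_bounded_linear[OF bounded_linear_vec_nth kernel_integrable[OF N Ei y], of i]
      by (simp add: matrix_vector_mult_def)
    also have "\<dots> = (\<Sum>j\<in>UNIV. (LINT z|leb a. N y z $ i $ j * E_op l d f z $ j))"
      using prod by simp
    also have "\<dots> = (\<Sum>j\<in>UNIV. d j *\<^sub>R (LINT s|leb l. N y (d j * s) $ i $ j * E_op l d f (d j * s) $ j))"
      using Ej by (intro sum.cong refl integral_scale_leb[OF d]) auto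
    also have "\<dots> = (\<Sum>j\<in>UNIV. (LINT s|leb l. N y (d j * s) $ i $ j * of_real (d j) * f s $ j))"
    proof (intro sum.cong refl)
      fix j
      have "d j *\<^sub>R (LINT s|leb l. N y (d j * s) $ i $ j * E_op l d f (d j * s) $ j) =
         (LINT s|leb l. d j *\<^sub>R (N y (d j * s) $ i $ j * E_op l d f (d j * s) $ j))" by simp
      also have "\<dots> = (LINT s|leb l. N y (d j * s) $ i $ j * of_real (d j) * f s $ j)"
        by (rule Bochner_Integration.integral_cong) (auto simp: Es space_restrict_space scaleR_conv_of_real)
      finally show "d j *\<^sub>R (LINT s|leb l. N y (d j * s) $ i $ j * E_op l d f (d j * s) $ j) =
         (LINT s|leb l. N y (d j * s) $ i $ j * of_real (d j) * f s $ j)" .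
    qed
    finally have L: "kernel_op a N (E_op l d f) y $ i
      = E_op l d f y $ i + (\<Sum>j\<in>UNIV. (LINT s|leb l. N y (d j * s) $ i $ j * of_real (d j) * f s $ j))"
      by (simp add: kernel_op_def)
    show "kernel_op a N (E_op l d f) y $ i = E_op l d (kernel_op l (dilate_kernel d N) f) y $ i"
    proof (cases "y < d i * l")
      case False
      then show ?thesis unfolding L using supp[of i y _ _] by (simp add: E_op_def)
    next
      case True
      define x where "x = y / d i"
      have yx: "y = d i * x" using d(1)[of i] by (simp add: x_def)
      have x: "x \<in> {0<..<l}" using True y d(1)[of i] by (auto simp: x_def field_simps)
      note Np = bounded_kernel_dilate[OF N d]
      have "(LINT s|leb l. dilate_kernel d N x s *v f s) $ i = (LINT s|leb l. (\<Sum>j\<in>UNIV. dilate_kernel d N x s $ i $ j * f s $ j))"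
        using integral_bounded_linear[OF bounded_linear_vec_nth[of i] kernel_integrable[OF Np L2_integrable[OF f] x]]
        by (simp add: matrix_vector_mult_def)
      also have "\<dots> = (\<Sum>j\<in>UNIV. (LINT s|leb l. dilate_kernel d N x s $ i $ j * f s $ j))"
        by (intro Bochner_Integration.integral_sum kernel_entry_integrable Np x fj)
      finally show ?thesis unfolding L using True y
        by (simp add: E_op_def kernel_op_def x_def[symmetric]) (simp add: yx dilate_kernel_def)
    qed
  qed
qed

lemma AE_lebesgue_scale:
  fixes c :: real
  assumes "c \<noteq> 0" "AE z in lebesgue. Q z" shows "AE x in lebesgue. Q (c * x)"
proof -
  have "negligible {z. \<not> Q z}"
    using assms(2) by (simp add: AE_iff_null_sets negligible_iff_null_sets completion.AE_iff_null_sets)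
  moreover have "linear (\<lambda>z::real. z / c)" by (auto intro!: linearI simp: add_divide_distrib)
  ultimately have "negligible ((\<lambda>z. z / c) ` {z. \<not> Q z})"
    by (intro negligible_differentiable_image_negligible linear_imp_differentiable_on) auto
  moreover have "(\<lambda>z. z / c) ` {z. \<not> Q z} = {x. \<not> Q (c * x)}"
    using assms(1) by (auto simp: image_iff) (metis nonzero_mult_div_cancel_left)
  ultimately show ?thesis by (simp add: negligible_iff_null_sets completion.AE_iff_null_sets)
qed

lemma E_op_inj_ae:
  fixes d :: "'p::finite \<Rightarrow> real"
  assumes d: "\<And>i. 0 < d i" "\<And>i. d i * l \<le> a"
    and eq: "ae_eq a (E_op l d f) (E_op l d g)"
  shows "ae_eq l f g"
proof -
  have "AE x in lebesgue. 0 < x \<and> x < l \<longrightarrow> f x $ j = g x $ j" for j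
  proof -
    have "AE x in lebesgue. 0 < d j * x \<and> d j * x < a \<longrightarrow> E_op l d f (d j * x) = E_op l d g (d j * x)"
      by (rule AE_lebesgue_scale) (use d(1)[of j] eq in \<open>auto simp: ae_eq_def AE_leb_iff\<close>)
    then show ?thesis
    proof (rule AE_mp, intro AE_I2 impI)
      fix x assume h: "0 < d j * x \<and> d j * x < a \<longrightarrow> E_op l d f (d j * x) = E_op l d g (d j * x)" and x: "0 < x \<and> x < l"
      then have "d j * x \<in> {0<..<a}" by (intro dilate_Ioo[OF d]) auto
      with h have "E_op l d f (d j * x) $ j = E_op l d g (d j * x) $ j" by simp
      then show "f x $ j = g x $ j" using x d(1)[of j] by (simp add: E_op_def)
    qed
  qed
  then have "AE x in lebesgue. \<forall>j. 0 < x \<and> x < l \<longrightarrow> f x $ j = g x $ j"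
    unfolding AE_all_countable by blast
  then show ?thesis unfolding ae_eq_def AE_leb_iff by (rule AE_mp) (auto simp: vec_eq_iff)
qed

section \<open>The fundamental solution U\<close>

text \<open>The standing data. The condition on $U_{22}(a)$ is added only where the two kernels are
  composed.\<close>

locale difference_kernel =
  fixes l :: real and k :: nat and ps :: "nat \<Rightarrow> nat" and dt :: "nat \<Rightarrow> real"
    and \<Theta>1 \<Theta>2 :: "complex^'p::{finite,linorder}^'n::finite"
    and \<beta> :: "complex^'n^'n"
  assumes l: "0 < l"
    and psum: "(\<Sum>j=1..k. ps j) = CARD('p)"
    and dec: "\<And>j. j \<in> {1..<k} \<Longrightarrow> dt (j + 1) < dt j"
    and dtk: "0 < dt k"
    and dt_last: "dt (k + 1) = 0"
begin

definition "d = (dd ps dt :: 'p \<Rightarrow> real)"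

definition "a = dt 1 * l"

definition "U = UU l k ps dt \<Theta>1 \<Theta>2 \<beta>"

text \<open>The points at which $U$ need not be differentiable, and at which \<^const>\<open>piece\<close>
  has no specified value.\<close>

definition "breaks = (\<lambda>j. dt j * l) ` {1..k+1}"

lemma finite_breaks: "finite breaks" by (simp add: breaks_def)

lemma dt_Suc: "1 \<le> j \<Longrightarrow> j \<le> k \<Longrightarrow> dt (Suc j) < dt j"
  using dec[of j] dtk dt_last by (cases "j = k") auto

lemma dt_strict: assumes "1 \<le> i" "i < j" "j \<le> k + 1" shows "dt j < dt i"
  using assms(2,3)
proof (induction j)
  case (Suc j)
  show ?case
  proof (cases "i = j")
    case True then show ?thesis using dt_Suc[of j] assms Suc by simp
  next
    case False
    then have "dt j < dt i" using Suc by simp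
    moreover have "dt (Suc j) < dt j" using dt_Suc[of j] False Suc assms by simp
    ultimately show ?thesis by simp
  qed
qed simp

lemma dt_mono: "1 \<le> i \<Longrightarrow> i \<le> j \<Longrightarrow> j \<le> k + 1 \<Longrightarrow> dt j \<le> dt i"
  using dt_strict[of i j] by (cases "i = j") auto

lemma pos_le: "pos (i::'p) \<le> (\<Sum>j=1..k. ps j)"
  unfolding psum pos_def by (rule card_mono) auto

lemma pos_pos: "0 < pos (i::'p)"
  unfolding pos_def by (subst card_gt_0_iff) auto

lemma blk_le_iff: "blk ps (i::'p) \<le> j \<longleftrightarrow> pos i \<le> (\<Sum>m=1..j. ps m)"
proof
  assume "blk ps i \<le> j"
  have "pos i \<le> (\<Sum>m=1..blk ps i. ps m)"
    unfolding blk_def by (rule LeastI[of _ k]) (rule pos_le)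
  also have "\<dots> \<le> (\<Sum>m=1..j. ps m)" using \<open>blk ps i \<le> j\<close> by (intro sum_mono2) auto
  finally show "pos i \<le> (\<Sum>m=1..j. ps m)" .
next
  assume "pos i \<le> (\<Sum>m=1..j. ps m)" then show "blk ps i \<le> j"
    unfolding blk_def by (rule Least_le)
qed

lemma blk_bounds: "1 \<le> blk ps (i::'p)" "blk ps (i::'p) \<le> k"
  using blk_le_iff[of i 0] pos_pos[of i] blk_le_iff[of i k] pos_le[of i] by auto

lemma d_pos: "0 < d i"
  using dt_mono[of "blk ps i" k] blk_bounds[of i] dtk by (simp add: d_def dd_def)

lemma d_le: "d i * l \<le> a"
  using dt_mono[of 1 "blk ps i"] blk_bounds[of i] l by (simp add: d_def dd_def a_def)

text \<open>The projection $P_j$ of the interval containing \<open>y\<close>, written so that it is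
  defined for every \<open>y\<close> and visibly measurable; the two forms are compared in
  \<open>PP_piece\<close>.\<close>

definition support_proj :: "real \<Rightarrow> complex^'p::{finite,linorder}^'p::{finite,linorder}" where
  "support_proj y = diagm (\<lambda>i. if y < d i * l then 1 else 0)"

lemma support_proj_idem: "support_proj y ** support_proj y = support_proj y"
  by (simp add: support_proj_def diagm_mult) (simp add: diagm_def vec_eq_iff)

text \<open>A component in the first $j-1$ blocks has $d_i \ge \widetilde d_{j-1}$, any other has $d_i \le
  \widetilde d_j$, and $y/l$ lies strictly between these two values.\<close>

lemma PP_eq_support_proj:
  assumes "2 \<le> j" "j \<le> k + 1" "dt j * l < y" "y < dt (j - 1) * l"
  shows "PP ps j = support_proj y"
proof -
  have "pos i \<le> (\<Sum>m=1..j-1. ps m) \<longleftrightarrow> y < d i * l" for i :: 'p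
  proof (cases "blk ps i \<le> j - 1")
    case True
    then have "dt (j - 1) \<le> d i" unfolding d_def dd_def
      using dt_mono[of "blk ps i" "j - 1"] blk_bounds[of i] assms by simp
    then have "y < d i * l" using assms(4) l by (meson less_le_trans mult_right_mono less_imp_le)
    with True show ?thesis by (simp add: blk_le_iff)
  next
    case False
    then have "d i \<le> dt j" unfolding d_def dd_def
      using dt_mono[of j "blk ps i"] blk_bounds[of i] assms by simp
    then have "d i * l \<le> dt j * l" using l by simp
    with False assms(3) show ?thesis by (simp add: blk_le_iff)
  qed
  then show ?thesis by (simp add: PP_def support_proj_def)
qed

lemma piece_exists:
  assumes "y \<in> {0<..<a} - breaks"
  obtains j where "2 \<le> j" "j \<le> k + 1" "dt j * l < y" "y < dt (j - 1) * l"
proof -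
  define j where "j = (LEAST j. 1 \<le> j \<and> dt j * l < y)"
  have ex: "1 \<le> k + 1 \<and> dt (k + 1) * l < y" using assms dt_last by simp
  have j: "1 \<le> j \<and> dt j * l < y" unfolding j_def using ex by (rule LeastI)
  have jk: "j \<le> k + 1" unfolding j_def using ex by (rule Least_le)
  have "j \<noteq> 1" using j assms by (auto simp: a_def)
  then have j2: "2 \<le> j" using j by simp
  have "\<not> (1 \<le> i \<and> dt i * l < y)" if "i < j" for i
    using that unfolding j_def by (rule not_less_Least)
  then have "\<not> (1 \<le> j - 1 \<and> dt (j - 1) * l < y)" using j2 by simp
  moreover have "1 \<le> j - 1" using j2 by simp
  ultimately have "y \<le> dt (j - 1) * l" by (meson not_less)
  moreover have "dt (j - 1) * l \<in> breaks" unfolding breaks_def by (rule imageI) (use j2 jk in auto)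
  then have "y \<noteq> dt (j - 1) * l" using assms by auto
  ultimately show ?thesis using that[of j] j2 jk j by simp
qed

lemma piece_eq:
  assumes "2 \<le> j" "j \<le> k + 1" "dt j * l < y" "y < dt (j - 1) * l"
  shows "piece l k dt y = j"
  unfolding piece_def
proof (rule the_equality)
  fix i assume i: "2 \<le> i \<and> i \<le> k + 1 \<and> dt i * l < y \<and> y < dt (i - 1) * l"
  have False if h: "2 \<le> i" "i < j" "j \<le> k + 1" "dt i * l < y" "y < dt (j - 1) * l" for i j
  proof -
    have "dt (j - 1) * l \<le> dt i * l" using dt_mono[of i "j - 1"] h l by simp
    with h show False by simp
  qed
  from this[of i j] this[of j i] i assms show "i = j" by (meson linorder_neqE_nat)
qed (use assms in simp)

lemma PP_piece: "y \<in> {0<..<a} - breaks \<Longrightarrow> PP ps (piece l k dt y) = support_proj y"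
  using piece_exists piece_eq PP_eq_support_proj by metis

definition Dinv :: "complex^'p::{finite,linorder}^'p::{finite,linorder}" where "Dinv = diagm (\<lambda>i. inverse (of_real (d i)))"

lemma matrix_inv_DD: "matrix_inv (DD ps dt) = Dinv"
proof (rule matrix_inv_eqI)
  have "Dinv ** DD ps dt = diagm (\<lambda>_. 1)"
    unfolding Dinv_def DD_def diagm_mult using d_pos by (simp add: d_def less_imp_neq[symmetric])
  then show "Dinv ** DD ps dt = mat 1" by (simp add: diagm_1)
qed

text \<open>The functions $C$ and $B$ before the projection $P(y)$ is applied.\<close>

definition C_full where "C_full y = hstack (cadj \<Theta>2) (cadj \<Theta>1) ** mexp (y *\<^sub>R AA \<beta>)"

definition B_full where "B_full y = mexp ((- y) *\<^sub>R AA \<beta>) ** vstack (- \<Theta>1) \<Theta>2 ** Dinv"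

text \<open>Versions of \<^const>\<open>CC\<close> and \<^const>\<open>BB\<close> that are also determined
  at the break points.\<close>

definition Cfun where "Cfun y = support_proj y ** C_full y"

definition Bfun where "Bfun y = B_full y ** support_proj y"

lemma CC_eq: "y \<in> {0<..<a} - breaks \<Longrightarrow> CC l k ps dt \<Theta>1 \<Theta>2 \<beta> y = Cfun y"
  by (simp add: CC_def PP_piece Cfun_def C_full_def matrix_mul_assoc)

lemma BB_eq: "y \<in> {0<..<a} - breaks \<Longrightarrow> BB l k ps dt \<Theta>1 \<Theta>2 \<beta> y = Bfun y"
  by (simp add: BB_def PP_piece Bfun_def B_full_def matrix_mul_assoc matrix_inv_DD)

lemma J_skew_AAx: "J_skew (AAx ps dt \<Theta>1 \<Theta>2 \<beta> j)"
proof -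
  have "cadj (Dinv ** PP ps j) = Dinv ** PP ps j"
    unfolding Dinv_def PP_def diagm_mult cadj_diagm by (simp add: if_distrib cong: if_cong)
  from J_skew_perturb[OF this, of \<Theta>1 \<Theta>2] show ?thesis
    unfolding AAx_def YY_def matrix_inv_DD
    by (intro J_skew_add J_skew_AA) (simp add: matrix_mul_assoc)
qed

lemma J_unitary_UU_upto: "J_unitary (UU_upto l k ps dt \<Theta>1 \<Theta>2 \<beta> m y)"
  by (induction m arbitrary: y)
     (auto simp: J_unitary_def[of "mat 1"] Let_def intro!: J_unitary_mult J_unitary_mexp J_skew_AAx
        simp del: scaleR_minus_left intro: J_skew_AA)

lemma J_unitary_U: "J_unitary (U y)" by (simp add: U_def UU_def J_unitary_UU_upto)

text \<open>Consecutive pieces agree at their common end point, where the middle exponential is the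
  identity and the outer ones cancel.\<close>

lemma continuous_UU_upto: "continuous_on UNIV (UU_upto l k ps dt \<Theta>1 \<Theta>2 \<beta> m)"
proof (induction m)
  case (Suc m)
  define c where "c = dt (k + 1 - m) * l"
  define f where "f = UU_upto l k ps dt \<Theta>1 \<Theta>2 \<beta> m"
  define g where "g y = mexp ((- y) *\<^sub>R AA \<beta>) ** mexp ((y - c) *\<^sub>R AAx ps dt \<Theta>1 \<Theta>2 \<beta> (k + 1 - m))
               ** mexp (c *\<^sub>R AA \<beta>) ** f c" for y
  have gc: "g c = f c" unfolding g_def using mexp_minus_mult[of c "AA \<beta>"] by simp
  have "continuous_on UNIV g" unfolding g_def
    by (intro matmul.continuous_on continuous_on_mexp_shift continuous_on_mexp_neg continuous_on_const)
  then have "continuous_on UNIV (\<lambda>y. if y \<le> c then f y else g y)"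
    using Suc gc unfolding f_def[symmetric]
    by (intro continuous_on_cases_le continuous_on_id) (auto intro: continuous_on_subset)
  moreover have "UU_upto l k ps dt \<Theta>1 \<Theta>2 \<beta> (Suc m) = (\<lambda>y. if y \<le> c then f y else g y)"
    by (simp add: fun_eq_iff Let_def c_def f_def g_def)
  ultimately show ?case by simp
qed simp

lemma continuous_U: "continuous_on UNIV U"
  unfolding U_def UU_def by (rule continuous_UU_upto)

lemma U_0: "U 0 = mat 1"
  unfolding U_def by (rule UU_rec(1)[OF l dec dtk dt_last])

text \<open>On the interval with index \<open>j\<close>, differentiating $e^{-yA}e^{(y-c)A^\times}X$ gives
  $e^{-yA}(A^\times - A)e^{yA}U(y)$, and $A^\times - A = Y_j$ is the product of the constant
  factors of $B$ and $C$ with the idempotent $P_j$ in the middle.\<close>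

lemma U_deriv:
  assumes y: "y \<in> {0<..<a} - breaks"
  shows "(U has_vector_derivative Bfun y ** Cfun y ** U y) (at y)"
proof -
  obtain j where j: "2 \<le> j" "j \<le> k + 1" "dt j * l < y" "y < dt (j - 1) * l"
    using piece_exists[OF y] by blast
  define c where "c = dt j * l"
  define X where "X = mexp (c *\<^sub>R AA \<beta>) ** U c"
  define A where "A = AA \<beta>"
  define Ax where "Ax = AAx ps dt \<Theta>1 \<Theta>2 \<beta> j"
  let ?f = "\<lambda>y. mexp ((- y) *\<^sub>R A) ** (mexp ((y - c) *\<^sub>R Ax) ** X)"
  have eq: "U x = ?f x" if "dt j * l < x" "x < dt (j - 1) * l" for x
    unfolding U_def A_def Ax_def X_def c_def
    using UU_rec(2)[OF l dec dtk dt_last j(1,2), of x] that by (simp add: matrix_mul_assoc)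
  have sh: "((\<lambda>y. mexp ((y - c) *\<^sub>R Ax)) has_vector_derivative Ax ** mexp ((y - c) *\<^sub>R Ax)) (at y)"
  proof -
    have "((\<lambda>y. y - c) has_vector_derivative 1) (at y)"
      by (auto intro!: derivative_eq_intros simp flip: has_real_derivative_iff_has_vector_derivative)
    from vector_diff_chain_at[OF this has_vector_derivative_mexp_at] show ?thesis by (simp add: o_def)
  qed
  have "(?f has_vector_derivative mexp ((- y) *\<^sub>R A) ** ((Ax - A) ** (mexp ((y - c) *\<^sub>R Ax) ** X))) (at y)"
    by (rule has_vector_derivative_eq_rhs[OF matmul.has_vector_derivative[OF has_vector_derivative_mexp_minus
        bounded_linear.has_vector_derivative[OF matmul.bounded_linear_left sh]]])
       (simp add: matmul.minus_left matmul.minus_right matmul.diff_left matmul.diff_right matrix_mul_assoc)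
  moreover have "mexp ((- y) *\<^sub>R A) ** ((Ax - A) ** (mexp ((y - c) *\<^sub>R Ax) ** X)) = Bfun y ** Cfun y ** U y"
  proof -
    have 1: "Ax - A = vstack (- \<Theta>1) \<Theta>2 ** Dinv ** support_proj y ** hstack (cadj \<Theta>2) (cadj \<Theta>1)"
      unfolding Ax_def A_def AAx_def YY_def matrix_inv_DD PP_eq_support_proj[OF j] by simp
    have 2: "mexp ((y - c) *\<^sub>R Ax) ** X = mexp (y *\<^sub>R A) ** U y"
      unfolding eq[OF j(3,4)] matrix_mul_assoc mexp_mult_minus by simp
    have "Bfun y ** Cfun y = B_full y ** (support_proj y ** support_proj y) ** C_full y" by (simp add: Bfun_def Cfun_def matrix_mul_assoc)
    then show ?thesis unfolding 1 2 by (simp add: support_proj_idem B_full_def C_full_def A_def matrix_mul_assoc)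
  qed
  ultimately have "(?f has_vector_derivative Bfun y ** Cfun y ** U y) (at y)" by simp
  then show ?thesis
    by (rule has_vector_derivative_transform_within_open[of _ _ _ "{dt j * l<..<dt (j - 1) * l}"])
       (use j eq in auto)
qed

definition Uinv where "Uinv y = J_inv (U y)"

lemma Uinv_U: "Uinv y ** U y = mat 1" and U_Uinv: "U y ** Uinv y = mat 1"
  unfolding Uinv_def using J_inv_left J_inv_right J_unitary_U by auto

lemma matrix_inv_U: "matrix_inv (U y) = Uinv y"
  unfolding Uinv_def using matrix_inv_J J_unitary_U by blast

lemma continuous_Uinv: "continuous_on UNIV Uinv"
  unfolding Uinv_def[abs_def] by (rule bounded_linear.continuous_on[OF bounded_linear_J_inv continuous_U])

text \<open>Differentiate $U^{-1}U = I$. The derivative of $U^{-1}$ exists because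
  \<^const>\<open>J_inv\<close> is real-linear.\<close>

lemma Uinv_deriv:
  assumes y: "y \<in> {0<..<a} - breaks"
  shows "(Uinv has_vector_derivative Uinv y ** Bfun y ** - Cfun y) (at y)"
proof -
  obtain W where W: "(Uinv has_vector_derivative W) (at y)"
    using bounded_linear.has_vector_derivative[OF bounded_linear_J_inv U_deriv[OF y]]
    unfolding Uinv_def[abs_def] by blast
  have "((\<lambda>y. Uinv y ** U y) has_vector_derivative (Uinv y ** (Bfun y ** Cfun y ** U y) + W ** U y)) (at y)"
    by (rule matmul.has_vector_derivative[OF W U_deriv[OF y]])
  then have "((\<lambda>y. mat 1) has_vector_derivative (Uinv y ** (Bfun y ** Cfun y ** U y) + W ** U y)) (at y)"
    by (simp add: Uinv_U)
  moreover have "((\<lambda>y. mat 1 :: complex^('n+'n)^('n+'n)) has_vector_derivative 0) (at y)" by simp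
  ultimately have "Uinv y ** (Bfun y ** Cfun y ** U y) + W ** U y = 0"
    by (rule vector_derivative_unique_at)
  then have "(Uinv y ** (Bfun y ** Cfun y ** U y) + W ** U y) ** Uinv y = 0" by simp
  then have "Uinv y ** Bfun y ** Cfun y ** (U y ** Uinv y) + W ** (U y ** Uinv y) = 0"
    by (simp add: matmul.add_left matrix_mul_assoc)
  then have "W = Uinv y ** Bfun y ** - Cfun y"
    by (simp add: U_Uinv matmul.minus_right eq_neg_iff_add_eq_0 add.commute)
  with W show ?thesis by simp
qed

end

section \<open>The kernels of S and of its inverse\<close>

context difference_kernel
begin

text \<open>The kernels of $E S E^{-1} - I$ and of $\widetilde T - I$, the former with its sign absorbed
  into the left factor.\<close>

definition "Sker = semisep (\<lambda>y. - Cfun y) proj1 proj2 Bfun"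

definition "Tker = semisep (\<lambda>y. Cfun y ** U y) (mat 1 - Pcross (U a)) (Pcross (U a)) (\<lambda>z. Uinv z ** Bfun z)"

text \<open>Only finitely many values occur, one for each set of components.\<close>

lemma bounded_borel_support_proj: "bounded_borel b support_proj"
  unfolding bounded_borel_def
proof
  show "support_proj \<in> borel_measurable borel"
    by (intro measurable_vec) (simp add: support_proj_def diagm_def)
  let ?g = "\<lambda>S::'p set. diagm (\<lambda>i. if i \<in> S then 1 else 0) :: complex^'p::{finite,linorder}^'p::{finite,linorder}"
  have "support_proj ` {0..b} \<subseteq> range ?g"
  proof
    fix X assume "X \<in> support_proj ` {0..b}"
    then obtain y where "X = ?g {i. y < d i * l}" unfolding support_proj_def by auto
    then show "X \<in> range ?g" by blast
  qed
  then show "bounded (support_proj ` {0..b})" by (meson finite_imp_bounded finite_imageI finite finite_subset)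
qed

lemma bounded_borel_Cfun: "bounded_borel b Cfun" and bounded_borel_Bfun: "bounded_borel b Bfun"
  unfolding Cfun_def[abs_def] Bfun_def[abs_def] C_full_def B_full_def
  by (intro bounded_borel_mult bounded_borel_support_proj bounded_borel_const bounded_borel_continuous continuous_on_mexp continuous_on_mexp_neg)+

lemma bounded_borel_minus_Cfun: "bounded_borel b (\<lambda>y. - Cfun y)"
proof -
  have "(\<lambda>y. - Cfun y) = (\<lambda>y. - mat 1 ** Cfun y)" by (simp add: matmul.minus_left)
  then show ?thesis by (simp only: bounded_borel_mult[OF bounded_borel_const bounded_borel_Cfun])
qed

lemma bounded_borel_U: "bounded_borel b U" and bounded_borel_Uinv: "bounded_borel b Uinv"
  by (rule bounded_borel_continuous continuous_U continuous_Uinv)+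

lemma bounded_kernel_Sker: "bounded_kernel b Sker"
  unfolding Sker_def by (intro bounded_kernel_semisep bounded_borel_minus_Cfun bounded_borel_Bfun)

lemma bounded_kernel_Tker: "bounded_kernel b Tker"
  unfolding Tker_def by (intro bounded_kernel_semisep bounded_borel_mult bounded_borel_Cfun bounded_borel_Bfun bounded_borel_U bounded_borel_Uinv)

lemma Sker_support: "d i * l \<le> y \<Longrightarrow> Sker y z $ i $ j = 0"
  unfolding Sker_def semisep_def Cfun_def
  by (simp add: matmul.minus_left matrix_mul_assoc[symmetric] support_proj_def diagm_mult_entry)

lemma Tker_support: "d i * l \<le> y \<Longrightarrow> Tker y z $ i $ j = 0"
  unfolding Tker_def semisep_def Cfun_def
  by (simp add: matrix_mul_assoc[symmetric] support_proj_def diagm_mult_entry)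

context
  assumes det: "det (block22 (U a)) \<noteq> 0"
begin

text \<open>The primitive is $U$. The products $U(z)U(z)^{-1}$ that appear cancel and leave the two
  kernels.\<close>

lemma Sker_Tker:
  assumes y: "y \<in> {0<..<a}" and z: "z \<in> {0<..<a}"
  shows "(LINT t|leb a. Sker y t ** Tker t z) = - Sker y z - Tker y z"
proof -
  have "(LINT t|leb a. Sker y t ** Tker t z) =
    (if z < y then - Cfun y ** (U y ** (mat 1 - Pcross (U a)) - proj1 ** U z) ** (Uinv z ** Bfun z)
     else - Cfun y ** (proj2 ** U z - U y ** Pcross (U a)) ** (Uinv z ** Bfun z))"
    unfolding Sker_def Tker_def
  proof (rule semisep_comp[OF _ _ _ _ finite_breaks _ _ proj_sum _ _ y z])
    show "continuous_on {0..a} U" by (rule continuous_on_subset[OF continuous_U]) simp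
    show "(U has_vector_derivative Bfun t ** (Cfun t ** U t)) (at t)" if "t \<in> {0<..<a} - breaks" for t
      using U_deriv[OF that] by (simp add: matrix_mul_assoc)
    show "proj1 ** U 0 ** Pcross (U a) = proj2 ** U a ** (mat 1 - Pcross (U a))"
      by (simp add: U_0 proj1_Pcross proj2_U_compl_Pcross[OF det])
  qed (auto intro!: bounded_borel_mult bounded_borel_minus_Cfun bounded_borel_Cfun bounded_borel_Bfun bounded_borel_U bounded_borel_Uinv)
  moreover have "X ** U z ** (Uinv z ** Bfun z) = X ** Bfun z" for X :: "complex^('n + 'n)^'p::{finite,linorder}"
  proof -
    have "X ** U z ** (Uinv z ** Bfun z) = X ** (U z ** Uinv z) ** Bfun z" by (simp only: matrix_mul_assoc)
    then show ?thesis by (simp add: U_Uinv)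
  qed
  ultimately show ?thesis
    unfolding Sker_def Tker_def semisep_def
    by (simp add: matmul.minus_left matmul.diff_left matmul.diff_right matmul.add_left matmul.add_right matrix_mul_assoc)
qed

text \<open>The primitive is $U^{-1}$.\<close>

lemma Tker_Sker:
  assumes y: "y \<in> {0<..<a}" and z: "z \<in> {0<..<a}"
  shows "(LINT t|leb a. Tker y t ** Sker t z) = - Tker y z - Sker y z"
proof -
  have "(LINT t|leb a. Tker y t ** Sker t z) =
    (if z < y then Cfun y ** U y ** (Uinv y ** proj1 - (mat 1 - Pcross (U a)) ** Uinv z) ** Bfun z
     else Cfun y ** U y ** (Pcross (U a) ** Uinv z - Uinv y ** proj2) ** Bfun z)"
    unfolding Sker_def Tker_def
  proof (rule semisep_comp[OF _ _ _ _ finite_breaks _ _ _ proj_sum _ y z])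
    show "continuous_on {0..a} Uinv" by (rule continuous_on_subset[OF continuous_Uinv]) simp
    show "(Uinv has_vector_derivative Uinv t ** Bfun t ** - Cfun t) (at t)" if "t \<in> {0<..<a} - breaks" for t
      using Uinv_deriv[OF that] .
    have "Uinv 0 = mat 1" using Uinv_U[of 0] by (simp add: U_0)
    then show "(mat 1 - Pcross (U a)) ** Uinv 0 ** proj2 = Pcross (U a) ** Uinv a ** proj1"
      by (simp add: compl_Pcross_proj2 Pcross_inv_proj1[OF det U_Uinv])
  qed (auto intro!: bounded_borel_mult bounded_borel_minus_Cfun bounded_borel_Cfun bounded_borel_Bfun bounded_borel_U bounded_borel_Uinv)
  moreover have "Cfun y ** U y ** (Uinv y ** X) = Cfun y ** X" for X :: "complex^('n + 'n)^('n + 'n)"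
  proof -
    have "Cfun y ** U y ** (Uinv y ** X) = Cfun y ** (U y ** Uinv y) ** X" by (simp only: matrix_mul_assoc)
    then show ?thesis by (simp add: U_Uinv)
  qed
  ultimately show ?thesis
    unfolding Sker_def Tker_def semisep_def
    by (simp add: matmul.minus_left matmul.diff_left matmul.diff_right matrix_mul_assoc)
qed

end

lemma mexp_AA: "mexp (y *\<^sub>R AA \<beta>) = block (mexp (y *\<^sub>R cscale \<i> (cadj \<beta>))) 0 0 (mexp (y *\<^sub>R cscale \<i> \<beta>))"
  unfolding AA_block mexp_block_diag ..

text \<open>Both projections commute with the block diagonal exponential, so each of them picks one of the
  two exponentials in $y - z$.\<close>

lemma C_full_proj_B_full:
  shows "C_full y ** proj1 ** B_full z = - (cadj \<Theta>2 ** mexp ((y - z) *\<^sub>R cscale \<i> (cadj \<beta>)) ** \<Theta>1 ** Dinv)"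
    and "C_full y ** proj2 ** B_full z = cadj \<Theta>1 ** mexp ((y - z) *\<^sub>R cscale \<i> \<beta>) ** \<Theta>2 ** Dinv"
proof -
  have ad: "mexp ((y - z) *\<^sub>R A) = mexp (y *\<^sub>R A) ** mexp ((- z) *\<^sub>R A)" for A :: "complex^'n^'n"
    using mexp_add[of y "- z" A] by simp
  have F: "C_full y ** proj1 = hstack (cadj \<Theta>2 ** mexp (y *\<^sub>R cscale \<i> (cadj \<beta>))) 0"
    "C_full y ** proj2 = hstack 0 (cadj \<Theta>1 ** mexp (y *\<^sub>R cscale \<i> \<beta>))"
    unfolding C_full_def mexp_AA proj1_def proj2_def by (simp_all add: hstack_block)
  have G: "B_full z = vstack (- (mexp ((- z) *\<^sub>R cscale \<i> (cadj \<beta>)) ** \<Theta>1)) (mexp ((- z) *\<^sub>R cscale \<i> \<beta>) ** \<Theta>2) ** Dinv"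
    unfolding B_full_def mexp_AA by (simp add: block_vstack matmul.minus_right)
  show "C_full y ** proj1 ** B_full z = - (cadj \<Theta>2 ** mexp ((y - z) *\<^sub>R cscale \<i> (cadj \<beta>)) ** \<Theta>1 ** Dinv)"
    unfolding F G ad by (simp add: matrix_mul_assoc hstack_vstack matmul.minus_left matmul.minus_right)
  show "C_full y ** proj2 ** B_full z = cadj \<Theta>1 ** mexp ((y - z) *\<^sub>R cscale \<i> \<beta>) ** \<Theta>2 ** Dinv"
    unfolding F G ad by (simp add: matrix_mul_assoc hstack_vstack matmul.minus_left matmul.minus_right)
qed

lemma kfun_eq:
  shows "0 < x \<Longrightarrow> kfun \<Theta>1 \<Theta>2 \<beta> x = cadj \<Theta>2 ** mexp (x *\<^sub>R cscale \<i> (cadj \<beta>)) ** \<Theta>1"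
    and "x \<le> 0 \<Longrightarrow> kfun \<Theta>1 \<Theta>2 \<beta> x = cadj \<Theta>1 ** mexp (x *\<^sub>R cscale \<i> \<beta>) ** \<Theta>2"
proof -
  show "0 < x \<Longrightarrow> kfun \<Theta>1 \<Theta>2 \<beta> x = cadj \<Theta>2 ** mexp (x *\<^sub>R cscale \<i> (cadj \<beta>)) ** \<Theta>1"
    by (simp add: kfun_def cscale_real)
  assume x: "x \<le> 0"
  then have "kfun \<Theta>1 \<Theta>2 \<beta> x = cadj (cadj \<Theta>2 ** mexp ((- x) *\<^sub>R cscale \<i> (cadj \<beta>)) ** \<Theta>1)"
    unfolding kfun_def cscale_real by simp
  also have "\<dots> = cadj \<Theta>1 ** (mexp ((- x) *\<^sub>R cadj (cscale \<i> (cadj \<beta>))) ** \<Theta>2)"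
    unfolding cadj_mult mexp_cadj by simp
  also have "(- x) *\<^sub>R cadj (cscale \<i> (cadj \<beta>)) = x *\<^sub>R cscale \<i> \<beta>"
    unfolding cadj_cscale by (simp add: cscale_minus)
  finally show "kfun \<Theta>1 \<Theta>2 \<beta> x = cadj \<Theta>1 ** mexp (x *\<^sub>R cscale \<i> \<beta>) ** \<Theta>2"
    by (simp add: matrix_mul_assoc)
qed

text \<open>The Jacobian \<open>d j\<close> compensates the factor $D^{-1}$ in $B$, and for $x$, $t$ in
  $(0,l)$ the projections act as the identity on the entry in question.\<close>

lemma dilate_Sker:
  assumes x: "x \<in> {0<..<l}" and t: "t \<in> {0<..<l}"
  shows "dilate_kernel d Sker x t = (\<chi> i j. kfun \<Theta>1 \<Theta>2 \<beta> (d i * x - d j * t) $ i $ j)"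
proof -
  have "Sker (d i * x) (d j * t) $ i $ j * of_real (d j) = kfun \<Theta>1 \<Theta>2 \<beta> (d i * x - d j * t) $ i $ j" for i j
  proof -
    let ?y = "d i * x" and ?z = "d j * t"
    have lt: "?y < d i * l" "?z < d j * l" using x t d_pos by auto
    have entry: "(Cfun ?y ** X ** Bfun ?z) $ i $ j = (C_full ?y ** X ** B_full ?z) $ i $ j" for X
    proof -
      have "Cfun ?y ** X ** Bfun ?z = support_proj ?y ** (C_full ?y ** X ** B_full ?z) ** support_proj ?z"
        by (simp add: Cfun_def Bfun_def matrix_mul_assoc)
      then show ?thesis using lt by (simp add: support_proj_def diagm_mult_entry mult_diagm_entry)
    qed
    have Sker: "Sker ?y ?z $ i $ j = (if ?z < ?y then - (C_full ?y ** proj1 ** B_full ?z) $ i $ j else (C_full ?y ** proj2 ** B_full ?z) $ i $ j)"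
      unfolding Sker_def semisep_def by (simp add: matmul.minus_left entry)
    have D: "(X ** Dinv) $ i $ j * of_real (d j) = X $ i $ j" for X :: "complex^'p::{finite,linorder}^'p::{finite,linorder}"
      using d_pos[of j] by (simp add: Dinv_def mult_diagm_entry)
    show ?thesis
    proof (cases "?z < ?y")
      case True
      then show ?thesis using kfun_eq(1)[of "?y - ?z"] unfolding Sker C_full_proj_B_full by (simp add: D)
    next
      case False
      then show ?thesis using kfun_eq(2)[of "?y - ?z"] unfolding Sker C_full_proj_B_full by (simp add: D)
    qed
  qed
  then show ?thesis by (simp add: dilate_kernel_def)
qed

lemma S_op_eq:
  assumes "x \<in> {0<..<l}"
  shows "S_op l d \<Theta>1 \<Theta>2 \<beta> f x = kernel_op l (dilate_kernel d Sker) f x"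
proof -
  have "(LINT t|leb l. (\<chi> i j. kfun \<Theta>1 \<Theta>2 \<beta> (d i * x - d j * t) $ i $ j) *v f t) = (LINT t|leb l. dilate_kernel d Sker x t *v f t)"
    by (rule Bochner_Integration.integral_cong) (auto simp: dilate_Sker[OF assms] space_restrict_space)
  then show ?thesis by (simp add: S_op_def kernel_op_def)
qed

lemma T_kernel_eq:
  assumes y: "y \<in> {0<..<a} - breaks" and z: "z \<in> {0<..<a} - breaks" and "y \<noteq> z"
  shows "T_kernel l k ps dt \<Theta>1 \<Theta>2 \<beta> y z = Tker y z"
  using assms(3) unfolding T_kernel_def Let_def U_def[symmetric] a_def[symmetric] CC_eq[OF y] BB_eq[OF z] matrix_inv_U
    Tker_def semisep_def by (auto simp: matrix_mul_assoc)

text \<open>The two kernels differ, as functions of $z$, only on the finite set formed by the break points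
  and $y$.\<close>

lemma T_op_eq:
  assumes y: "y \<in> {0<..<a} - breaks"
  shows "T_op l k ps dt \<Theta>1 \<Theta>2 \<beta> g y = kernel_op a Tker g y"
proof -
  have "(LINT z|leb a. T_kernel l k ps dt \<Theta>1 \<Theta>2 \<beta> y z *v g z) = (LINT z|leb a. Tker y z *v g z)"
  proof (rule integral_discrete_difference[where X = "(insert y breaks) \<inter> {0<..<a}"])
    show "countable (insert y breaks \<inter> {0<..<a})" using finite_breaks by (simp add: countable_finite)
    show "{x} \<in> sets (leb a)" if "x \<in> insert y breaks \<inter> {0<..<a}" for x
      using that by (auto simp: sets_restrict_space_iff)
    show "emeasure (leb a) {x} = 0" if "x \<in> insert y breaks \<inter> {0<..<a}" for x
      using that by (subst emeasure_restrict_space) auto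
    show "T_kernel l k ps dt \<Theta>1 \<Theta>2 \<beta> y z *v g z = Tker y z *v g z"
      if "z \<in> space (leb a)" "z \<notin> insert y breaks \<inter> {0<..<a}" for z
      using T_kernel_eq[OF y, of z] that by (auto simp: space_restrict_space)
  qed
  then show ?thesis by (simp add: T_op_def kernel_op_def a_def)
qed

lemma AE_not_break: "AE y in leb a. y \<notin> breaks"
proof -
  have "breaks \<in> null_sets lebesgue" using finite_breaks by (simp add: finite_imp_null_set_lborel null_sets_completionI)
  from AE_not_in[OF this] show ?thesis unfolding AE_leb_iff by (rule AE_mp) simp
qed

lemma T_op_E:
  assumes f: "f \<in> L2 l"
  shows "ae_eq a (E_op l d (kernel_op l (dilate_kernel d Tker) f)) (T_op l k ps dt \<Theta>1 \<Theta>2 \<beta> (E_op l d f))"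
  unfolding ae_eq_def
proof (rule AE_mp[OF AE_not_break], rule AE_leb_I, rule impI)
  fix y assume y: "y \<in> {0<..<a}" "y \<notin> breaks"
  show "E_op l d (kernel_op l (dilate_kernel d Tker) f) y = T_op l k ps dt \<Theta>1 \<Theta>2 \<beta> (E_op l d f) y"
    using E_kernel_op[OF bounded_kernel_Tker d_pos d_le Tker_support f y(1)] T_op_eq[of y] y by simp
qed

text \<open>Since $E$ is injective up to null sets, the representative chosen by
  \<^const>\<open>E_inv\<close> agrees almost everywhere with the integral operator whose kernel
  is the dilated kernel of $\widetilde T$.\<close>

lemma S_op_inverse:
  assumes det: "det (block22 (U a)) \<noteq> 0"
  shows "f \<in> L2 l \<Longrightarrow> in_range_E l a d (T_op l k ps dt \<Theta>1 \<Theta>2 \<beta> (E_op l d f))"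
    and "L2_inverse l (S_op l d \<Theta>1 \<Theta>2 \<beta>) (\<lambda>f. E_inv l a d (T_op l k ps dt \<Theta>1 \<Theta>2 \<beta> (E_op l d f)))"
proof -
  note bK = bounded_kernel_dilate[OF bounded_kernel_Sker[of a] d_pos d_le]
  note bG = bounded_kernel_dilate[OF bounded_kernel_Tker[of a] d_pos d_le]
  let ?T = "\<lambda>f. T_op l k ps dt \<Theta>1 \<Theta>2 \<beta> (E_op l d f)"
  have range: "kernel_op l (dilate_kernel d Tker) f \<in> L2 l \<and> ae_eq a (E_op l d (kernel_op l (dilate_kernel d Tker) f)) (?T f)"
    if "f \<in> L2 l" for f using kernel_op_L2[OF bG that] T_op_E[OF that] by simp
  then show "in_range_E l a d (?T f)" if "f \<in> L2 l" for f
    using that unfolding in_range_E_def by blast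
  have inv: "E_inv l a d (?T f) \<in> L2 l \<and> ae_eq a (E_op l d (E_inv l a d (?T f))) (?T f)" if "f \<in> L2 l" for f
    unfolding E_inv_def
    by (rule someI[of "\<lambda>g. g \<in> L2 l \<and> ae_eq a (E_op l d g) (?T f)", OF range[OF that]])
  note dl = dilate_Ioo[OF d_pos d_le]
  show "L2_inverse l (S_op l d \<Theta>1 \<Theta>2 \<beta>) (\<lambda>f. E_inv l a d (?T f))"
  proof (rule L2_inverse_kernel_op[OF l bK bG])
    fix x t assume x: "x \<in> {0<..<l}" and t: "t \<in> {0<..<l}"
    show "(LINT s|leb l. dilate_kernel d Sker x s ** dilate_kernel d Tker s t) = - dilate_kernel d Sker x t - dilate_kernel d Tker x t"
      by (subst dilate_kernel_comp[OF bounded_kernel_Sker bounded_kernel_Tker d_pos d_le _ x t], erule Tker_support)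
        (simp add: dilate_kernel_def vec_eq_iff Sker_Tker[OF det dl[OF x] dl[OF t]] left_diff_distrib)
    show "(LINT s|leb l. dilate_kernel d Tker x s ** dilate_kernel d Sker s t) = - dilate_kernel d Tker x t - dilate_kernel d Sker x t"
      by (subst dilate_kernel_comp[OF bounded_kernel_Tker bounded_kernel_Sker d_pos d_le _ x t], erule Sker_support)
        (simp add: dilate_kernel_def vec_eq_iff Tker_Sker[OF det dl[OF x] dl[OF t]] left_diff_distrib)
  next
    fix f :: "real \<Rightarrow> complex^'p::{finite,linorder}" assume f: "f \<in> L2 l"
    show "E_inv l a d (?T f) \<in> L2 l" using inv[OF f] by simp
    show "ae_eq l (E_inv l a d (?T f)) (kernel_op l (dilate_kernel d Tker) f)"
    proof (rule E_op_inj_ae)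
      show "ae_eq a (E_op l d (E_inv l a d (?T f))) (E_op l d (kernel_op l (dilate_kernel d Tker) f))"
        using inv[OF f] ae_eq_sym[of a "E_op l d (kernel_op l (dilate_kernel d Tker) f)"] range[OF f] ae_eq_trans by blast
    qed (rule d_pos d_le)+
  qed (rule S_op_eq)
qed

end

theorem theorem2p3:
  fixes l a :: real and k :: nat and ps :: "nat \<Rightarrow> nat" and dt :: "nat \<Rightarrow> real"
    and \<Theta>1 \<Theta>2 :: "complex^'p::{finite,linorder}^'n::finite"
    and \<beta> :: "complex^'n^'n"
    and d :: "'p \<Rightarrow> real"
  assumes "0 < l"
    and "\<And>j. j \<in> {1..k} \<Longrightarrow> 0 < ps j"
    and "(\<Sum>j=1..k. ps j) = CARD('p)"
    and "\<And>j. j \<in> {1..<k} \<Longrightarrow> dt (j + 1) < dt j"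
    and "0 < dt k"
    and "dt (k + 1) = 0"
    and "d = dd ps dt"
    and "a = dt 1 * l"
    and "det (block22 (UU l k ps dt \<Theta>1 \<Theta>2 \<beta> a)) \<noteq> 0"
  shows "L2_invertible l (S_op l d \<Theta>1 \<Theta>2 \<beta>) \<and>
    (\<forall>f \<in> L2 l. in_range_E l a d (T_op l k ps dt \<Theta>1 \<Theta>2 \<beta> (E_op l d f))) \<and>
    L2_inverse l (S_op l d \<Theta>1 \<Theta>2 \<beta>)
           (\<lambda>f. E_inv l a d (T_op l k ps dt \<Theta>1 \<Theta>2 \<beta> (E_op l d f))) \<and>
    (\<forall>y \<in> {0..a}. cadj (UU l k ps dt \<Theta>1 \<Theta>2 \<beta> y) ** JJ ** UU l k ps dt \<Theta>1 \<Theta>2 \<beta> y = JJ)"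
proof -
  interpret D: difference_kernel l k ps dt \<Theta>1 \<Theta>2 \<beta>
    by unfold_locales (use assms in auto)
  have a: "a = D.a" and d: "d = D.d" using assms by (simp_all add: D.a_def D.d_def)
  have det: "det (block22 (D.U D.a)) \<noteq> 0" using assms(9) by (simp add: a D.U_def)
  have "\<forall>f \<in> L2 l. in_range_E l a d (T_op l k ps dt \<Theta>1 \<Theta>2 \<beta> (E_op l d f))"
    unfolding a d using D.S_op_inverse(1)[OF det] by blast
  moreover have inv: "L2_inverse l (S_op l d \<Theta>1 \<Theta>2 \<beta>)
      (\<lambda>f. E_inv l a d (T_op l k ps dt \<Theta>1 \<Theta>2 \<beta> (E_op l d f)))"
    unfolding a d by (rule D.S_op_inverse(2)[OF det])
  moreover have "\<forall>y \<in> {0..a}. cadj (UU l k ps dt \<Theta>1 \<Theta>2 \<beta> y) ** JJ ** UU l k ps dt \<Theta>1 \<Theta>2 \<beta> y = JJ"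
    using D.J_unitary_U by (simp add: D.U_def J_unitary_def)
  ultimately show ?thesis unfolding L2_invertible_def by blast
qed

end
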